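(* Let $d\geq 1$, let $(X,\mu)$ be a non-atomic probability space, and let $(U_{\boldsymbol t})_{\boldsymbol t\in\mathbb{R}^d}$ be a measurable, measure-preserving $d$-dimensional flow on $X$. Let $\{\boldsymbol w_k\}_{k\in\mathbb{N}}\subset\mathbb{R}^d$ and $\{\boldsymbol s_k\}_{k\in\mathbb{N}}\subset(0,+\infty)^d$ be sequences, with associated boxes $B_k$, averaging operators $R_k$ and sets $\Omega_i^{(\alpha)}(\lambda)$ as defined in the context. Assume that the flow $U_{\boldsymbol t}$ is aperiodic and that it commutes with a mixing family $\{S_h\}$ of measure-preserving transformations of $X$. Assume moreover that for some $1\leq i\leq d$ the following holds: for all $A,\alpha>0$, $$\mathrm{Leb}\left(\Omega_i^{(\alpha)}(\lambda)\right)\geq A\lambda\quad\text{for an unbounded set of }\lambda>0.$$ Then the operators $R_k$ have the strong sweeping out property, that is, for every $\varepsilon>0$ there exists a measurable set $B_\varepsilon\subset X$ with $\mu(B_\varepsilon)<\varepsilon$ such that for $\mu$-a.e. $x\in X$ $$\liminf_{k\to\infty}R_k\chi_{B_\varepsilon}(x)=0\quad\text{and}\quad\limsup_{k\to\infty}R_k\chi_{B_\varepsilon}(x)=1.$$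
   Context: $\mathrm{Leb}$ is Lebesgue measure on $\mathbb{R}$ and $\chi_E$ is the characteristic function of $E$. A measurable, measure-preserving $d$-dimensional flow on $X$ is a jointly measurable action $(\boldsymbol t,x)\mapsto U_{\boldsymbol t}x$ of $\mathbb{R}^d$ on $X$ by $\mu$-preserving transformations. The flow is aperiodic if there is a set $N\subset X$ with $\mu(N)=0$ such that $U_{\boldsymbol t}x\neq x$ for all $x\in X\setminus N$ and all $\boldsymbol t\in\mathbb{R}^d\setminus\{\boldsymbol 0\}$. A family $\{S_h\}$ of measure-preserving transformations of $X$ is called mixing if for every pair of measurable sets $A,B\subset X$ and every $\rho>1$ there exists $h$ such that $\mu(A\cap S_h^{-1}(B))\leq\rho\,\mu(A)\mu(B)$. (This is weaker than, and different from, the notion of a mixing action.) The flow commutes with the family if each $U_{\boldsymbol t}$ commutes with each $S_h$. Given the sequences $\boldsymbol w_k=(w_{k1},\dots,w_{kd})$ and $\boldsymbol s_k=(s_{k1},\dots,s_{kd})$, put $$B_k:=[w_{k1},w_{k1}+s_{k1})\times\cdots\times[w_{kd},w_{kd}+s_{kd}),\qquad R_kf(x):=\frac{1}{s_{k1}\cdots s_{kd}}\int_{B_k}f(U_{\boldsymbol t}x)\,d\boldsymbol t\quad (f\in L^1(X)).$$ For $i=1,\dots,d$ let $\Omega_i:=\{(w_{ki},s_{ki}):k\in\mathbb{N}\}$. For $\alpha>0$ let $$\Omega_i^{(\alpha)}:=\{(x,y)\in\mathbb{R}\times(0,+\infty): |x-t|\leq\alpha(y-s)\text{ for some }(t,s)\in\Omega_i\},$$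 and for $\lambda>0$ let $\Omega_i^{(\alpha)}(\lambda):=\{x\in\mathbb{R}:(x,\lambda)\in\Omega_i^{(\alpha)}\}$.
   Formalization: The probability space is assumed in addition to have, up to a null set, countably many measurable sets separating its points (as every Lebesgue or standard space does); without such a convention the claim fails. *)

theory Defs
  imports "HOL-Probability.Probability"
begin

definition measure_preserving_on :: "'a measure \<Rightarrow> ('a \<Rightarrow> 'a) \<Rightarrow> bool" where
  "measure_preserving_on M T \<longleftrightarrow> T \<in> M \<rightarrow>\<^sub>M M \<and> distr M M T = M"

definition nonatomic :: "'a measure \<Rightarrow> bool" where
  "nonatomic M \<longleftrightarrow>
     (\<forall>A\<in>sets M. emeasure M A > 0 \<longrightarrow>
        (\<exists>B\<in>sets M. B \<subseteq> A \<and> 0 < emeasure M B \<and> emeasure M B < emeasure M A))"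

text \<open>
  The part of the usual "Lebesgue space" convention of ergodic theory that is kept here: up to a
  null set, countably many measurable sets separate the points. Every standard Borel and every
  Lebesgue--Rokhlin probability space has this property. Some such convention is indispensable,
  because aperiodicity speaks about points: on \<open>\<real> \<times> Y\<close> with the \<open>\<sigma>\<close>-algebra of all sets
  \<open>\<real> \<times> B\<close>, translation of the first coordinate moves every point, but fixes every
  measurable set.
\<close>

definition countably_separated_ae :: "'a measure \<Rightarrow> bool" where
  "countably_separated_ae M \<longleftrightarrow>
     (\<exists>N\<in>null_sets M. \<exists>C. countable C \<and> C \<subseteq> sets M \<and>
        (\<forall>x\<in>space M - N. \<forall>y\<in>space M - N. x \<noteq> y \<longrightarrow> (\<exists>E\<in>C. (x \<in> E) \<noteq> (y \<in> E))))"

definition measurable_mp_flow :: "'a measure \<Rightarrow> (real ^ 'd \<Rightarrow> 'a \<Rightarrow> 'a) \<Rightarrow> bool" where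
  "measurable_mp_flow M U \<longleftrightarrow>
     (\<lambda>(t, x). U t x) \<in> borel \<Otimes>\<^sub>M M \<rightarrow>\<^sub>M M \<and>
     (\<forall>x\<in>space M. U 0 x = x) \<and>
     (\<forall>s t. \<forall>x\<in>space M. U (s + t) x = U s (U t x)) \<and>
     (\<forall>t. measure_preserving_on M (U t))"

definition aperiodic_flow :: "'a measure \<Rightarrow> (real ^ 'd \<Rightarrow> 'a \<Rightarrow> 'a) \<Rightarrow> bool" where
  "aperiodic_flow M U \<longleftrightarrow>
     (\<exists>N\<in>null_sets M. \<forall>x\<in>space M - N. \<forall>t. t \<noteq> 0 \<longrightarrow> U t x \<noteq> x)"

definition mixing_family :: "'a measure \<Rightarrow> ('h \<Rightarrow> 'a \<Rightarrow> 'a) \<Rightarrow> bool" where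
  "mixing_family M S \<longleftrightarrow>
     (\<forall>h. measure_preserving_on M (S h)) \<and>
     (\<forall>A\<in>sets M. \<forall>B\<in>sets M. \<forall>\<rho>>1. \<exists>h.
        measure M (A \<inter> (S h -` B \<inter> space M)) \<le> \<rho> * measure M A * measure M B)"

definition flow_commutes_with_family ::
    "'a measure \<Rightarrow> (real ^ 'd \<Rightarrow> 'a \<Rightarrow> 'a) \<Rightarrow> ('h \<Rightarrow> 'a \<Rightarrow> 'a) \<Rightarrow> bool" where
  "flow_commutes_with_family M U S \<longleftrightarrow> (\<forall>t h. \<forall>x\<in>space M. U t (S h x) = S h (U t x))"

definition avg_box :: "real ^ 'd \<Rightarrow> real ^ 'd \<Rightarrow> (real ^ 'd) set" where
  "avg_box w s = {t. \<forall>i. w $ i \<le> t $ i \<and> t $ i < w $ i + s $ i}"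

definition avg_op ::
    "(real ^ 'd \<Rightarrow> 'a \<Rightarrow> 'a) \<Rightarrow> real ^ 'd \<Rightarrow> real ^ 'd \<Rightarrow> ('a \<Rightarrow> real) \<Rightarrow> 'a \<Rightarrow> real" where
  "avg_op U w s f x = (1 / (\<Prod>i\<in>UNIV. s $ i)) * (LINT t:avg_box w s|lborel. f (U t x))"

definition Omega :: "(nat \<Rightarrow> real ^ 'd) \<Rightarrow> (nat \<Rightarrow> real ^ 'd) \<Rightarrow> 'd \<Rightarrow> (real \<times> real) set" where
  "Omega w s i = {(w k $ i, s k $ i) |k. True}"

definition cone_set :: "(real \<times> real) set \<Rightarrow> real \<Rightarrow> (real \<times> real) set" where
  "cone_set \<Omega> \<alpha> = {(x, y). y > 0 \<and> (\<exists>(t, s)\<in>\<Omega>. \<bar>x - t\<bar> \<le> \<alpha> * (y - s))}"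

definition cone_section :: "(real \<times> real) set \<Rightarrow> real \<Rightarrow> real \<Rightarrow> real set" where
  "cone_section \<Omega> \<alpha> y = {x. (x, y) \<in> cone_set \<Omega> \<alpha>}"

text \<open>
  The lower and upper limits are taken in \<^typ>\<open>ereal\<close>, since \<^typ>\<open>real\<close> is not a complete lattice.
\<close>

definition strong_sweeping_out :: "'a measure \<Rightarrow> (nat \<Rightarrow> ('a \<Rightarrow> real) \<Rightarrow> 'a \<Rightarrow> real) \<Rightarrow> bool" where
  "strong_sweeping_out M R \<longleftrightarrow>
     (\<forall>\<epsilon>>0. \<exists>B\<in>sets M. measure M B < \<epsilon> \<and>
        (AE x in M. liminf (\<lambda>k. ereal (R k (indicator B) x)) = 0 \<and>
                    limsup (\<lambda>k. ereal (R k (indicator B) x)) = 1))"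

end

theory Submission
  imports Defs
begin

text \<open>
  The set \<open>B\<close> is assembled from sets \<open>E\<close> of tiny measure that are hit completely: for most points \<open>x\<close>,
  some box \<open>x + B\<^sub>k\<close> of the orbit, with \<open>k\<close> from a prescribed finite range of late indices, lies
  entirely in \<open>E\<close>, so that the average of \<open>\<chi>\<^sub>E\<close> over it is \<open>1\<close>. Three steps produce such sets.

  Geometry. Let \<open>y\<close> be such that the section of the cone set at height \<open>y\<close>, for the aperture
  \<open>\<alpha> = 1\<close>, has measure at least \<open>A y\<close>. It is the union of the intervals with centre \<open>w\<^sub>k\<^sub>i\<close> and radius
  \<open>y - s\<^sub>k\<^sub>i\<close>. If \<open>v\<close> is in the \<open>k\<close>-th interval, then \<open>v - [w\<^sub>k\<^sub>i, w\<^sub>k\<^sub>i + s\<^sub>k\<^sub>i)\<close> stays inside \<open>[-y, y]\<close>.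
  Hence the \<open>i\<close>-th sides of the reflected boxes at a set of positions of measure \<open>A y\<close> all fit into one
  interval of length \<open>2 y\<close>. In the other directions all sets are taken as intervals much longer than
  the boxes that occur, so that boundary effects cost a constant factor only. This gives a region
  \<open>V\<close> of positions and a region \<open>P\<close> with \<open>|V| \<ge> C |P|\<close>, for \<open>C\<close> as large as desired, such that from
  each \<open>v \<in> V\<close> some reflected box \<open>v - B\<^sub>k\<close> lies in \<open>P\<close> (lemma \<open>ex_swept_region\<close>).

  Transfer. A copy of a large bounded piece of \<open>\<real>\<^sup>d\<close> is found in \<open>X\<close>: a set \<open>D\<close> of positive measure to
  which an orbit cannot return at a time from a given compact set that omits \<open>0\<close> (lemma
  \<open>ex_positive_set_avoiding_compact_times\<close>). The points that visit \<open>D\<close> during \<open>P\<close> form a set \<open>E\<close> whose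
  measure is at most \<open>|P|\<close> times some unit, and those that visit a thickening of \<open>D\<close> during \<open>V\<close> form a
  set \<open>F\<close> whose measure is at least a dimensional constant times \<open>|V|\<close> of the same units (lemma
  \<open>ex_tower\<close>). So \<open>\<mu> F \<ge> C \<mu> E\<close> up to that constant, while every point of \<open>F\<close> has an orbit box inside
  \<open>E\<close> (lemma \<open>ex_swept_set\<close>).

  Spreading. Pulling \<open>E\<close> and \<open>F\<close> back along members of the mixing family, which commutes with the flow,
  preserves this relation, and the pull-backs of \<open>F\<close> can be chosen almost independent. A
  number of them of order \<open>1 / \<mu> F\<close> covers all but a small part of the space, while the pull-backs of \<open>E\<close> have total measure of
  order \<open>1 / C\<close> (lemma \<open>ex_almost_full_swept_set\<close>).

  Finally, sets \<open>E\<^sub>0, E\<^sub>1, \<dots>\<close> of this kind are chosen one after the other, each tiny compared with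
  all its predecessors; the odd ones are added to \<open>B\<close> and the even ones removed. A late set changes the
  earlier averages by a negligible amount, so for almost every \<open>x\<close> the averages of \<open>\<chi>\<^sub>B\<close> come close to
  \<open>1\<close> through the odd stages and close to \<open>0\<close> through the even ones (lemma
  \<open>strong_sweeping_out_if_swept\<close>).
\<close>

section \<open>Lebesgue measure of boxes and translates\<close>

lemma emeasure_lborel_vec_product:
  fixes A :: "'d::finite \<Rightarrow> real set"
  assumes [measurable]: "\<And>j. A j \<in> sets borel"
  shows "emeasure lborel {u :: real ^ 'd. \<forall>j. u $ j \<in> A j} = (\<Prod>j\<in>UNIV. emeasure lborel (A j))"
proof -
  define g :: "real ^ 'd \<Rightarrow> real \<Rightarrow> ennreal" where "g b = indicator (A (axis_index b))" for b
  have reindex: "(\<Prod>b\<in>Basis. h b) = (\<Prod>j\<in>UNIV. h (axis j 1))" for h :: "real ^ 'd \<Rightarrow> ennreal"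
  proof -
    have "Basis = range (\<lambda>j. axis j 1 :: real ^ 'd)"
      by (auto simp: Basis_vec_def)
    moreover have "inj (\<lambda>j. axis j 1 :: real ^ 'd)"
      by (simp add: inj_on_def axis_eq_axis)
    ultimately show ?thesis
      by (intro prod.reindex_cong) auto
  qed
  have "indicator {u. \<forall>j. u $ j \<in> A j} u = (\<Prod>b\<in>Basis. g b (u \<bullet> b))" for u
  proof -
    have "(\<Prod>b\<in>Basis. g b (u \<bullet> b)) = (\<Prod>j\<in>UNIV. indicator (A j) (u $ j))"
      by (simp add: reindex g_def inner_axis)
    also have "\<dots> = indicator {u. \<forall>j. u $ j \<in> A j} u"
      by (auto simp: indicator_def intro!: prod.neutral)
    finally show ?thesis by simp
  qed
  moreover have meas: "{u :: real ^ 'd. \<forall>j. u $ j \<in> A j} \<in> sets lborel"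
    by measurable
  ultimately have "emeasure lborel {u :: real ^ 'd. \<forall>j. u $ j \<in> A j}
      = (\<integral>\<^sup>+u. (\<Prod>b\<in>Basis. g b (u \<bullet> b)) \<partial>lborel)"
    by (simp flip: nn_integral_indicator)
  also have "\<dots> = (\<Prod>b\<in>Basis. (\<integral>\<^sup>+x. g b x \<partial>lborel))"
    by (rule nn_integral_lborel_prod) (auto simp: g_def)
  also have "\<dots> = (\<Prod>j\<in>UNIV. emeasure lborel (A j))"
    by (simp add: reindex g_def)
  finally show ?thesis .
qed

definition rational_points :: "'a::euclidean_space set" where
  "rational_points = {q. \<forall>b\<in>Basis. q \<bullet> b \<in> \<rat>}"

lemma countable_rational_points: "countable (rational_points :: 'a::euclidean_space set)"
proof -
  have "rational_points \<subseteq> (\<lambda>f. \<Sum>b\<in>Basis. f b *\<^sub>R b) ` (Basis \<rightarrow>\<^sub>E (\<rat> :: real set) :: ('a \<Rightarrow> real) set)"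
  proof
    fix q :: 'a assume "q \<in> rational_points"
    then have "restrict (\<lambda>b. q \<bullet> b) Basis \<in> Basis \<rightarrow>\<^sub>E \<rat>"
      by (auto simp: rational_points_def)
    moreover have "q = (\<Sum>b\<in>Basis. restrict (\<lambda>b. q \<bullet> b) Basis b *\<^sub>R b)"
      by (simp add: euclidean_representation)
    ultimately show "q \<in> (\<lambda>f. \<Sum>b\<in>Basis. f b *\<^sub>R b) ` (Basis \<rightarrow>\<^sub>E \<rat>)"
      by blast
  qed
  then show ?thesis
    by (rule countable_subset) (intro countable_image countable_PiE finite_Basis countable_rat)
qed

text \<open>
  Rational boxes form a countable intersection-stable generator of the Borel sets, so they determine
  the measures with densities \<open>\<chi>\<^sub>Z\<close> and \<open>\<chi>\<^sub>Z'\<close>, and a density is unique almost everywhere. Countability of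
  the family of test boxes is what matters later.
\<close>

lemma AE_eq_if_agree_on_rational_boxes:
  fixes Z Z' :: "'a::euclidean_space set"
  assumes [measurable]: "Z \<in> sets borel" "Z' \<in> sets borel"
  assumes agree: "\<And>a b. a \<in> rational_points \<Longrightarrow> b \<in> rational_points \<Longrightarrow>
      measure lborel (Z \<inter> box a b) = measure lborel (Z' \<inter> box a b)"
  shows "AE u in lborel. u \<in> Z \<longleftrightarrow> u \<in> Z'"
proof -
  define E where "E = {box a b |a b :: 'a. a \<in> rational_points \<and> b \<in> rational_points}"
  have E_count: "countable E"
  proof -
    have "E = (\<lambda>(a, b). box a b) ` (rational_points \<times> rational_points)"
      by (auto simp: E_def)
    then show ?thesis
      by (simp only:) (intro countable_image countable_SIGMA countable_rational_points)
  qed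
  have open_UN_E: "\<exists>I\<subseteq>E. S = \<Union>I" if "open S" for S :: "'a set"
  proof (intro exI conjI)
    show "{B\<in>E. B \<subseteq> S} \<subseteq> E" by auto
    show "S = \<Union>{B\<in>E. B \<subseteq> S}"
    proof (intro equalityI subsetI)
      fix x assume "x \<in> S"
      then obtain e where e: "e > 0" "ball x e \<subseteq> S"
        using \<open>open S\<close> open_contains_ball by blast
      obtain a b where "\<forall>i\<in>Basis. a \<bullet> i \<in> \<rat> \<and> b \<bullet> i \<in> \<rat>" "x \<in> box a b" "box a b \<subseteq> ball x e"
        using rational_boxes[OF e(1)] by metis
      with e show "x \<in> \<Union>{B\<in>E. B \<subseteq> S}"
        unfolding E_def rational_points_def by blast
    qed auto
  qed
  have sigma_E: "sets borel = sigma_sets UNIV E"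
  proof -
    have "borel = sigma UNIV ((\<lambda>S. S) ` E)"
    proof (rule borel_eq_sigmaI1[OF borel_def])
      fix S :: "'a set" assume "S \<in> {S. open S}"
      then obtain I where "I \<subseteq> E" "S = \<Union>I"
        using open_UN_E by auto
      moreover have "countable I"
        using \<open>I \<subseteq> E\<close> E_count by (rule countable_subset)
      moreover have "I \<subseteq> sets (sigma UNIV E)"
        using \<open>I \<subseteq> E\<close> by auto
      ultimately show "S \<in> sets (sigma UNIV ((\<lambda>S. S) ` E))"
        using sets.countable_Union[of I "sigma UNIV E"] by simp
    qed (auto simp: E_def)
    then have "sets borel = sets (sigma UNIV E)"
      by simp
    then show ?thesis
      by simp
  qed
  have Int_E: "Int_stable E"
  proof (rule Int_stableI)
    fix A B assume "A \<in> E" "B \<in> E"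
    then obtain a b c d where AB: "A = box a b" "B = box c d"
      and rat: "a \<in> rational_points" "b \<in> rational_points" "c \<in> rational_points" "d \<in> rational_points"
      unfolding E_def by blast
    have "A \<inter> B = box (\<Sum>i\<in>Basis. max (a \<bullet> i) (c \<bullet> i) *\<^sub>R i) (\<Sum>i\<in>Basis. min (b \<bullet> i) (d \<bullet> i) *\<^sub>R i)"
      unfolding AB box_Int_box ..
    moreover have "(\<Sum>i\<in>Basis. max (a \<bullet> i) (c \<bullet> i) *\<^sub>R i) \<in> rational_points"
      "(\<Sum>i\<in>Basis. min (b \<bullet> i) (d \<bullet> i) *\<^sub>R i) \<in> rational_points"
      using rat by (simp_all add: rational_points_def max_def min_def)
    ultimately show "A \<inter> B \<in> E"
      unfolding E_def by blast
  qed
  have fin: "emeasure lborel (Y \<inter> box a b) \<noteq> \<infinity>" for Y and a b :: 'a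
    using emeasure_mono[of "Y \<inter> box a b" "box a b" lborel] emeasure_lborel_box_finite[of a b] by auto
  have "density lborel (indicator Z) = density lborel (indicator Z')"
  proof (rule measure_eqI_generator_eq_countable[OF Int_E _ _ _ _ _ _ E_count])
    fix X assume "X \<in> E"
    then obtain a b where X: "X = box a b" "a \<in> rational_points" "b \<in> rational_points"
      by (auto simp: E_def)
    have "emeasure lborel (Z \<inter> X) = emeasure lborel (Z' \<inter> X)"
      using agree[OF X(2,3)] fin[of Z a b] fin[of Z' a b] by (simp add: X emeasure_eq_ennreal_measure)
    then show "emeasure (density lborel (indicator Z)) X = emeasure (density lborel (indicator Z')) X"
      by (simp add: X emeasure_density nn_integral_indicator flip: indicator_inter_arith)
  next
    show "\<Union>E = UNIV"
      using open_UN_E[OF open_UNIV] by blast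
  next
    fix X assume "X \<in> E"
    then obtain a b where X: "X = box a b" by (auto simp: E_def)
    show "emeasure (density lborel (indicator Z)) X \<noteq> \<infinity>"
      using fin[of Z a b]
      by (simp add: X emeasure_density nn_integral_indicator flip: indicator_inter_arith)
  qed (auto simp: sigma_E)
  then have "AE u in lborel. indicator Z u = (indicator Z' u :: ennreal)"
    by (intro sigma_finite_measure.density_unique[OF sigma_finite_lborel]) auto
  then show ?thesis
    by eventually_elim (auto simp: indicator_def split: if_splits)
qed

text \<open>
  The indicators of the translated boxes converge except on the translated boundary of the limit box,
  which is a null set; so dominated convergence applies although \<open>Z\<close> is merely measurable.
\<close>

lemma measure_Int_translated_box_tendsto:
  fixes Z :: "'a::euclidean_space set"
  assumes [measurable]: "Z \<in> sets borel" and t: "t \<longlonglongrightarrow> t0"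
  shows "(\<lambda>n. measure lborel (Z \<inter> {v. v - t n \<in> box a b})) \<longlonglongrightarrow> measure lborel (Z \<inter> {v. v - t0 \<in> box a b})"
proof -
  define f :: "'a \<Rightarrow> 'a \<Rightarrow> real" where "f s v = indicator (Z \<inter> {v. v - s \<in> box a b}) v" for s v
  have meas [measurable]: "Z \<inter> {v. v - s \<in> box a b} \<in> sets borel" for s
    by measurable
  have [measurable]: "f s \<in> borel_measurable lborel" for s
    unfolding f_def by measurable
  obtain B where B: "\<And>n. norm (t n) \<le> B"
    using convergent_imp_Bseq[of t] t by (auto simp: convergent_def Bseq_def)
  obtain R where R: "\<And>x. x \<in> box a b \<Longrightarrow> norm x \<le> R"
    using bounded_box[of a b] by (auto simp: bounded_iff)
  have "(\<lambda>n. integral\<^sup>L lborel (f (t n))) \<longlonglongrightarrow> integral\<^sup>L lborel (f t0)"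
  proof (rule integral_dominated_convergence[where w="indicator (cball 0 (R + B))"])
    \<comment> \<open>all boxes \<open>t n + box a b\<close> lie in the ball of radius \<open>R + B\<close>\<close>
    show "integrable lborel (indicator (cball 0 (R + B)) :: 'a \<Rightarrow> real)"
      using emeasure_lborel_cball_finite[of "0::'a" "R + B"] by simp
    show "AE v in lborel. norm (f (t n) v) \<le> indicator (cball 0 (R + B)) v" for n
    proof (rule AE_I2)
      fix v show "norm (f (t n) v) \<le> indicator (cball 0 (R + B)) v"
        using R[of "v - t n"] B[of n] norm_triangle_ineq[of "v - t n" "t n"]
        by (auto simp: f_def indicator_def)
    qed
    have "cbox a b - box a b \<in> null_sets lborel"
    proof (rule null_setsI)
      show "emeasure lborel (cbox a b - box a b) = 0"
        by (subst emeasure_Diff) (auto simp: emeasure_lborel_box_eq emeasure_lborel_cbox_eq box_subset_cbox less_imp_le)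
    qed auto
    then have "AE v in distr lborel borel ((+) (-t0)). v \<notin> cbox a b - box a b"
      unfolding lborel_distr_plus by (rule AE_not_in)
    then have "AE v in lborel. v - t0 \<notin> cbox a b - box a b"
      by (subst (asm) AE_distr_iff) auto
    then show "AE v in lborel. (\<lambda>n. f (t n) v) \<longlonglongrightarrow> f t0 v"
    proof eventually_elim
      fix v assume v: "v - t0 \<notin> cbox a b - box a b"
      have conv: "(\<lambda>n. v - t n) \<longlonglongrightarrow> v - t0"
        by (intro tendsto_intros t)
      consider "v - t0 \<in> box a b" | "v - t0 \<in> - cbox a b" using v by auto
      then have "\<forall>\<^sub>F n in sequentially. f (t n) v = f t0 v"
      proof cases
        case 1
        then have "\<forall>\<^sub>F n in sequentially. v - t n \<in> box a b"
          using topological_tendstoD[OF conv open_box] by simp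
        then show ?thesis
          by (rule eventually_mono) (use 1 in \<open>auto simp: f_def indicator_def\<close>)
      next
        case 2
        then have "\<forall>\<^sub>F n in sequentially. v - t n \<in> - cbox a b"
          using topological_tendstoD[OF conv, of "- cbox a b"] by (simp add: closed_cbox open_Compl)
        then show ?thesis
          by (rule eventually_mono) (use 2 box_subset_cbox[of a b] in \<open>auto simp: f_def indicator_def\<close>)
      qed
      then show "(\<lambda>n. f (t n) v) \<longlonglongrightarrow> f t0 v"
        by (rule tendsto_eventually)
    qed
  qed auto
  then show ?thesis
    unfolding f_def by simp
qed

lemma emeasure_lborel_shift:
  fixes S :: "'e::euclidean_space set"
  assumes [measurable]: "S \<in> sets borel"
  shows "emeasure lborel {v. v + t \<in> S} = emeasure lborel S"
proof -
  have "emeasure lborel S = emeasure (distr lborel borel ((+) t)) S"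
    by (simp add: lborel_distr_plus)
  also have "\<dots> = emeasure lborel {v. v + t \<in> S}"
    by (subst emeasure_distr) (auto intro!: arg_cong[where f="emeasure lborel"] simp: add.commute)
  finally show ?thesis by simp
qed

lemma emeasure_lborel_vec_cube:
  fixes a :: "'d::finite \<Rightarrow> real"
  assumes "l \<ge> 0"
  shows "emeasure lborel {u :: real ^ 'd. \<forall>j. u $ j \<in> {a j..a j + l}} = ennreal l ^ CARD('d)"
    and "emeasure lborel {u :: real ^ 'd. \<forall>j. u $ j \<in> {a j..<a j + l}} = ennreal l ^ CARD('d)"
  using assms by (simp_all only: emeasure_lborel_vec_product atLeastAtMost_borel atLeastLessThan_borel) simp_all

lemma prod_if_one:
  fixes a b :: "'b::comm_monoid_mult" and i :: "'d::finite"
  shows "(\<Prod>j\<in>UNIV. if j = i then a else b) = a * b ^ (CARD('d) - 1)"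
  by (subst prod.remove[of _ i]) (auto simp: card_Diff_singleton)

section \<open>Occupation times of orbits\<close>

locale mp_flow = prob_space M for M :: "'a measure" +
  fixes U :: "real ^ 'd \<Rightarrow> 'a \<Rightarrow> 'a"
  assumes mp_flow: "measurable_mp_flow M U"
begin

lemma flow_measurable_pair: "(\<lambda>(t, x). U t x) \<in> borel \<Otimes>\<^sub>M M \<rightarrow>\<^sub>M M"
  and flow_0: "x \<in> space M \<Longrightarrow> U 0 x = x"
  and flow_add: "x \<in> space M \<Longrightarrow> U (s + t) x = U s (U t x)"
  and flow_mp: "measure_preserving_on M (U t)"
  using mp_flow by (auto simp: measurable_mp_flow_def)

lemma measurable_flow [measurable (raw)]:
  assumes [measurable]: "f \<in> N \<rightarrow>\<^sub>M borel" "g \<in> N \<rightarrow>\<^sub>M M"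
  shows "(\<lambda>x. U (f x) (g x)) \<in> N \<rightarrow>\<^sub>M M"
proof -
  have "(\<lambda>x. (f x, g x)) \<in> N \<rightarrow>\<^sub>M borel \<Otimes>\<^sub>M M"
    by measurable
  from measurable_compose[OF this flow_measurable_pair] show ?thesis
    by simp
qed

lemma flow_measurable: "U t \<in> M \<rightarrow>\<^sub>M M"
  using flow_mp by (simp add: measure_preserving_on_def)

lemma flow_space [simp]: "x \<in> space M \<Longrightarrow> U t x \<in> space M"
  by (rule measurable_space[OF flow_measurable])

lemma emeasure_flow_vimage:
  assumes "A \<in> sets M"
  shows "emeasure M {x\<in>space M. U t x \<in> A} = emeasure M A"
proof -
  have "emeasure M A = emeasure (distr M M (U t)) A"
    using flow_mp by (simp add: measure_preserving_on_def)
  also have "\<dots> = emeasure M {x\<in>space M. U t x \<in> A}"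
    using assms flow_measurable by (subst emeasure_distr) (auto intro!: arg_cong[where f="emeasure M"])
  finally show ?thesis by simp
qed

lemma flow_cancel: "x \<in> space M \<Longrightarrow> U (- t) (U t x) = x"
  using flow_add[of x "- t" t] by (simp add: flow_0)

definition visits :: "'a set \<Rightarrow> 'a \<Rightarrow> (real ^ 'd) set" where
  "visits A x = {u. U u x \<in> A}"

text \<open>
  Towers are built from points whose occupation time of a window is positive rather than from points that
  visit \<open>A\<close> at some time in it: the occupation time is measurable in \<open>x\<close> by Fubini, whereas the mere
  existence of a visit need not define a measurable set.
\<close>

definition occupation :: "(real ^ 'd) set \<Rightarrow> 'a set \<Rightarrow> 'a \<Rightarrow> ennreal" where
  "occupation W A x = emeasure lborel (W \<inter> visits A x)"

lemma visits_borel [measurable]: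
  assumes "x \<in> space M" "A \<in> sets M"
  shows "visits A x \<in> sets borel"
proof -
  have "visits A x = (\<lambda>t. U t x) -` A \<inter> space borel"
    by (auto simp: visits_def)
  then show ?thesis
    using measurable_sets[of "\<lambda>t. U t x" borel M A] assms by simp
qed

lemma visits_flow: "x \<in> space M \<Longrightarrow> u \<in> visits A (U t x) \<longleftrightarrow> u + t \<in> visits A x"
  by (simp add: visits_def flow_add)

lemma occupation_flow:
  assumes "x \<in> space M" "A \<in> sets M" "W \<in> sets borel"
  shows "occupation W A (U t x) = emeasure lborel ({v. v - t \<in> W} \<inter> visits A x)"
proof -
  have [measurable]: "visits A x \<in> sets borel" "W \<in> sets borel"
    using assms by auto
  have "W \<inter> visits A (U t x) = {v. v + t \<in> {v. v - t \<in> W} \<inter> visits A x}"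
    using assms(1) by (auto simp: visits_flow)
  then show ?thesis
    unfolding occupation_def by (simp only:) (rule emeasure_lborel_shift, measurable)
qed

lemma occupation_eq_nn_integral:
  assumes "x \<in> space M" "A \<in> sets M" "W \<in> sets borel"
  shows "occupation W A x = (\<integral>\<^sup>+t. indicator W t * indicator A (U t x) \<partial>lborel)"
proof -
  have [measurable]: "visits A x \<in> sets borel" "W \<in> sets borel"
    using assms by auto
  have "indicator W t * indicator A (U t x) = (indicator (W \<inter> visits A x) t :: ennreal)" for t
    by (auto simp: indicator_def visits_def)
  then show ?thesis
    by (simp add: occupation_def)
qed

lemma occupation_measurable [measurable]:
  assumes [measurable]: "A \<in> sets M" "W \<in> sets borel"
  shows "occupation W A \<in> borel_measurable M"
proof -
  have "(\<lambda>x. \<integral>\<^sup>+t. indicator W t * indicator A (U t x) \<partial>lborel) \<in> borel_measurable M"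
    by measurable
  then show ?thesis
    by (subst measurable_cong[OF occupation_eq_nn_integral]) (use assms in auto)
qed

text \<open>
  Fubini and invariance: at each instant the probability of being in \<open>A\<close> is \<open>\<mu> A\<close>. This identity is the
  bridge between measures of sets of points and measures of sets of times.
\<close>

lemma nn_integral_occupation:
  assumes [measurable]: "A \<in> sets M" "W \<in> sets borel"
  shows "(\<integral>\<^sup>+x. occupation W A x \<partial>M) = emeasure lborel W * emeasure M A"
proof -
  interpret pair_sigma_finite "lborel :: (real ^ 'd) measure" M ..
  have "(\<integral>\<^sup>+x. occupation W A x \<partial>M) = (\<integral>\<^sup>+x. (\<integral>\<^sup>+t. indicator W t * indicator A (U t x) \<partial>lborel) \<partial>M)"
    by (intro nn_integral_cong occupation_eq_nn_integral) auto
  also have "\<dots> = (\<integral>\<^sup>+t. (\<integral>\<^sup>+x. indicator W t * indicator A (U t x) \<partial>M) \<partial>lborel)"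
    by (rule Fubini') measurable
  also have "\<dots> = (\<integral>\<^sup>+t. indicator W t * emeasure M A \<partial>lborel)"
  proof (rule nn_integral_cong)
    fix t :: "real ^ 'd"
    have "(\<integral>\<^sup>+x. indicator A (U t x) \<partial>M) = (\<integral>\<^sup>+x. indicator {x\<in>space M. U t x \<in> A} x \<partial>M)"
      by (intro nn_integral_cong) (auto simp: indicator_def)
    also have "\<dots> = emeasure M A"
      by (subst nn_integral_indicator) (auto simp: emeasure_flow_vimage)
    finally show "(\<integral>\<^sup>+x. indicator W t * indicator A (U t x) \<partial>M) = indicator W t * emeasure M A"
      by (subst nn_integral_cmult) auto
  qed
  also have "\<dots> = emeasure lborel W * emeasure M A"
    by (simp add: nn_integral_multc)
  finally show ?thesis .
qed

lemma AE_orbit_avoids_null_set: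
  assumes "N \<in> null_sets M"
  shows "AE x in M. AE u in lborel. U u x \<notin> N"
proof -
  have [measurable]: "N \<in> sets M" using assms by auto
  have "(\<integral>\<^sup>+x. occupation UNIV N x \<partial>M) = 0"
    using assms by (simp add: nn_integral_occupation null_setsD1)
  then have "AE x in M. occupation UNIV N x = 0"
    by (subst (asm) nn_integral_0_iff_AE) auto
  then have "AE x in M. x \<in> space M \<longrightarrow> (AE u in lborel. U u x \<notin> N)"
  proof eventually_elim
    fix x assume 0: "occupation UNIV N x = 0"
    show "x \<in> space M \<longrightarrow> (AE u in lborel. U u x \<notin> N)"
    proof
      assume x: "x \<in> space M"
      then have "visits N x \<in> null_sets lborel"
        using 0 by (auto simp: occupation_def)
      then show "AE u in lborel. U u x \<notin> N"
        using AE_not_in[of "visits N x" lborel] by (simp add: visits_def)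
    qed
  qed
  then show ?thesis
    by (rule AE_mp) (auto intro!: AE_I2)
qed

end

section \<open>Sets without return at given times\<close>

context mp_flow begin

text \<open>
  For fixed \<open>A\<close>, \<open>a\<close> and \<open>b\<close> this is a real function on the space that is continuous along orbits, even though
  \<open>\<chi>\<^sub>A\<close> is not: the average over a box of times smooths it.
\<close>

definition sojourn :: "'a set \<Rightarrow> real ^ 'd \<Rightarrow> real ^ 'd \<Rightarrow> 'a \<Rightarrow> real" where
  "sojourn A a b x = measure lborel (visits A x \<inter> box a b)"

lemma sojourn_measurable [measurable]:
  assumes [measurable]: "A \<in> sets M"
  shows "sojourn A a b \<in> borel_measurable M"
proof -
  have "sojourn A a b = (\<lambda>x. enn2real (occupation (box a b) A x))"
    by (simp add: fun_eq_iff sojourn_def occupation_def measure_def Int_commute)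
  then show ?thesis
    by simp
qed

lemma sojourn_flow:
  assumes "x \<in> space M" "A \<in> sets M"
  shows "sojourn A a b (U t x) = measure lborel (visits A x \<inter> {v. v - t \<in> box a b})"
  using occupation_flow[OF assms, of "box a b" t]
  by (simp add: sojourn_def occupation_def measure_def Int_commute)

lemma continuous_sojourn_along_orbit:
  assumes x: "x \<in> space M" and A: "A \<in> sets M"
  shows "continuous_on UNIV (\<lambda>t. sojourn A a b (U t x))"
  by (rule continuous_on_sequentiallyI)
     (simp add: sojourn_flow[OF x A] measure_Int_translated_box_tendsto visits_borel[OF x A])

text \<open>
  Countably many sojourn times distinguish almost every point from all other points of its orbit. If they
  agree at \<open>x\<close> and \<open>U t x\<close>, then for almost every \<open>u\<close> the points \<open>U u x\<close> and \<open>U u (U t x)\<close> belong to the same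
  sets of the separating family. Choosing \<open>u\<close> so that both avoid the exceptional null set makes
  them equal; hence \<open>U t x = x\<close>, and \<open>t = 0\<close> by aperiodicity.
\<close>

lemma AE_sojourn_separates_orbit:
  assumes aper: "aperiodic_flow M U"
    and N: "N \<in> null_sets M" and C: "countable C" "C \<subseteq> sets M"
    and sep: "\<And>x y. x \<in> space M - N \<Longrightarrow> y \<in> space M - N \<Longrightarrow> x \<noteq> y \<Longrightarrow> \<exists>A\<in>C. (x \<in> A) \<noteq> (y \<in> A)"
  shows "AE x in M. \<forall>t. t \<noteq> 0 \<longrightarrow> (\<exists>A\<in>C. \<exists>a\<in>rational_points. \<exists>b\<in>rational_points.
           sojourn A a b x \<noteq> sojourn A a b (U t x))"
proof -
  obtain N1 where N1: "N1 \<in> null_sets M" and free: "\<And>x t. x \<in> space M - N1 \<Longrightarrow> t \<noteq> 0 \<Longrightarrow> U t x \<noteq> x"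
    using aper by (auto simp: aperiodic_flow_def)
  have "AE x in M. x \<in> space M \<and> x \<notin> N1 \<and> (AE u in lborel. U u x \<notin> N)"
    using AE_space AE_not_in[OF N1] AE_orbit_avoids_null_set[OF N] by eventually_elim auto
  then show ?thesis
  proof eventually_elim
    case (elim x)
    then have x: "x \<in> space M" "x \<notin> N1" and avoids: "AE u in lborel. U u x \<notin> N" by auto
    show ?case
    proof (intro allI impI, rule ccontr)
      fix t :: "real ^ 'd"
      assume "t \<noteq> 0"
      assume "\<not> (\<exists>A\<in>C. \<exists>a\<in>rational_points. \<exists>b\<in>rational_points. sojourn A a b x \<noteq> sojourn A a b (U t x))"
      then have agree: "measure lborel (visits A x \<inter> box a b) = measure lborel (visits A (U t x) \<inter> box a b)"
        if "A \<in> C" "a \<in> rational_points" "b \<in> rational_points" for A a b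
        using that unfolding sojourn_def by blast
      have "AE u in lborel. u \<in> visits A x \<longleftrightarrow> u \<in> visits A (U t x)" if "A \<in> C" for A
        using that x(1) C(2) agree[OF that]
        by (intro AE_eq_if_agree_on_rational_boxes visits_borel) auto
      then have same: "AE u in lborel. \<forall>A\<in>C. u \<in> visits A x \<longleftrightarrow> u \<in> visits A (U t x)"
        by (simp add: AE_ball_countable[OF C(1)])
      have "AE u in distr lborel borel ((+) t). U u x \<notin> N"
        unfolding lborel_distr_plus by (rule avoids)
      then have "AE u in lborel. U (t + u) x \<notin> N"
        using x N by (subst (asm) AE_distr_iff) auto
      then have "AE u in lborel. U u (U t x) \<notin> N"
        by eventually_elim (simp add: flow_add[OF x(1), symmetric] add.commute)
      with avoids same have meet: "AE u in lborel. (U u x \<notin> N \<and> U u (U t x) \<notin> N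
          \<and> (\<forall>A\<in>C. u \<in> visits A x \<longleftrightarrow> u \<in> visits A (U t x)))"
        by eventually_elim auto
      have "ae_filter (lborel :: (real ^ 'd) measure) \<noteq> bot"
        by (simp add: ae_filter_eq_bot_iff)
      from eventually_happens'[OF this meet] obtain u where u: "U u x \<notin> N" "U u (U t x) \<notin> N"
          "\<And>A. A \<in> C \<Longrightarrow> u \<in> visits A x \<longleftrightarrow> u \<in> visits A (U t x)"
        by auto
      then have "U u x = U u (U t x)"
        using sep[of "U u x" "U u (U t x)"] x(1) by (auto simp: visits_def)
      then have "U (- u) (U u x) = U (- u) (U u (U t x))"
        by (rule arg_cong)
      then have "U t x = x"
        by (simp only: flow_cancel flow_space x(1))
      then show False
        using free[of x t] x \<open>t \<noteq> 0\<close> by auto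
    qed
  qed
qed

text \<open>
  This replaces a Rokhlin tower for the flow. By continuity along orbits and compactness of \<open>K\<close>, finitely
  many sojourn times already separate \<open>x\<close> from all \<open>U t x\<close>, \<open>t \<in> K\<close>, by a fixed gap \<open>1 / Suc n\<close>.
  Sorting the points by the values of these functions, rounded to half that gap, leaves countably many
  classes; two points of one class cannot be separated by the gap, and some class has positive measure.
\<close>

lemma ex_positive_set_avoiding_compact_times:
  assumes aper: "aperiodic_flow M U" and cs: "countably_separated_ae M"
    and K: "compact K" "0 \<notin> K"
  obtains D where "D \<in> sets M" "emeasure M D > 0" "\<And>x t. x \<in> D \<Longrightarrow> t \<in> K \<Longrightarrow> U t x \<notin> D"
proof -
  from cs[unfolded countably_separated_ae_def] obtain N where N: "N \<in> null_sets M"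
    and ex_C: "\<exists>C. countable C \<and> C \<subseteq> sets M \<and>
      (\<forall>x\<in>space M - N. \<forall>y\<in>space M - N. x \<noteq> y \<longrightarrow> (\<exists>E\<in>C. (x \<in> E) \<noteq> (y \<in> E)))"
    by (rule bexE)
  from ex_C obtain C where C: "countable C" "C \<subseteq> sets M"
    and sep: "\<forall>x\<in>space M - N. \<forall>y\<in>space M - N. x \<noteq> y \<longrightarrow> (\<exists>E\<in>C. (x \<in> E) \<noteq> (y \<in> E))"
    by (elim exE conjE)
  define I where "I = insert {} C \<times> (rational_points :: (real ^ 'd) set) \<times> (rational_points :: (real ^ 'd) set)"
  have "countable I"
    unfolding I_def using C(1) by (intro countable_SIGMA countable_insert countable_rational_points)
  moreover have "({}, 0, 0) \<in> I"
    by (simp add: I_def rational_points_def)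
  ultimately have I: "countable I" "I \<noteq> {}"
    by auto
  define e where "e = from_nat_into I"
  have e: "range e = I"
    unfolding e_def by (rule range_from_nat_into[OF I(2,1)])
  define \<phi> where "\<phi> j = (case e j of (A, a, b) \<Rightarrow> sojourn A a b)" for j
  have ej: "\<exists>A a b. A \<in> sets M \<and> \<phi> j = sojourn A a b" for j
  proof -
    have "e j \<in> I" using e by blast
    then obtain A a b where "e j = (A, a, b)" "A \<in> insert {} C"
      unfolding I_def by blast
    moreover have "insert {} C \<subseteq> sets M"
      using C(2) by simp
    ultimately have "A \<in> sets M \<and> \<phi> j = sojourn A a b"
      unfolding \<phi>_def by auto
    then show ?thesis by blast
  qed
  have [measurable]: "\<phi> j \<in> borel_measurable M" for j
    using ej[of j] sojourn_measurable by metis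
  have cont: "continuous_on UNIV (\<lambda>t. \<phi> j (U t x))" if "x \<in> space M" for j x
    using ej[of j] continuous_sojourn_along_orbit[OF that] by metis
  obtain K0 where K0: "countable K0" "K0 \<subseteq> K" "K \<subseteq> closure K0"
    using separable by blast
  \<comment> \<open>The gap is required only for times in a countable dense subset of \<open>K\<close>, to keep \<open>D\<close> measurable; it
    extends to \<open>K\<close> because it is a closed condition on \<open>t\<close>.\<close>
  define gap where "gap n t x \<longleftrightarrow> (\<exists>j<n. 1 / Suc n \<le> \<bar>\<phi> j x - \<phi> j (U t x)\<bar>)" for n t x
  \<comment> \<open>the list \<open>c\<close> holds the rounded values of the first \<open>n\<close> functions\<close>
  define D where "D p = (case p of (n, c) \<Rightarrow> {x\<in>space M. (\<forall>t\<in>K0. gap n t x)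
      \<and> (\<forall>j<n. \<lfloor>2 * Suc n * \<phi> j x\<rfloor> = c ! j)})" for p :: "nat \<times> int list"
  have D_sets: "D p \<in> sets M" for p
    unfolding D_def gap_def using K0(1) by (cases p) (simp, measurable)
  have D_avoids: "U t x \<notin> D p" if xD: "x \<in> D p" and tK: "t \<in> K" for x t p
  proof
    assume y: "U t x \<in> D p"
    obtain n c where p: "p = (n, c)" by (cases p)
    have x: "x \<in> space M" and dense: "\<forall>t\<in>K0. gap n t x"
      and cx: "\<And>j. j < n \<Longrightarrow> \<lfloor>2 * Suc n * \<phi> j x\<rfloor> = c ! j"
      and cy: "\<And>j. j < n \<Longrightarrow> \<lfloor>2 * Suc n * \<phi> j (U t x)\<rfloor> = c ! j"
      using xD y by (auto simp: D_def p)
    have "closed {t. gap n t x}"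
    proof -
      have "{t. gap n t x} = (\<Union>j<n. {t. 1 / Suc n \<le> \<bar>\<phi> j x - \<phi> j (U t x)\<bar>})"
        by (auto simp: gap_def)
      moreover have "closed {t. 1 / Suc n \<le> \<bar>\<phi> j x - \<phi> j (U t x)\<bar>}" for j
        by (intro closed_Collect_le continuous_intros cont x)
      ultimately show ?thesis
        by (simp only:) (intro closed_UN finite_lessThan ballI)
    qed
    then have "closure K0 \<subseteq> {t. gap n t x}"
      using dense by (intro closure_minimal) auto
    then obtain j where j: "j < n" "1 / Suc n \<le> \<bar>\<phi> j x - \<phi> j (U t x)\<bar>"
      using K0(3) tK by (auto simp: gap_def)
    have "\<lfloor>2 * Suc n * \<phi> j x\<rfloor> = \<lfloor>2 * Suc n * \<phi> j (U t x)\<rfloor>"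
      using cx cy j by simp
    then have "\<bar>2 * Suc n * \<phi> j x - 2 * Suc n * \<phi> j (U t x)\<bar> < 1"
      by linarith
    moreover have "\<bar>2 * Suc n * \<phi> j x - 2 * Suc n * \<phi> j (U t x)\<bar> = 2 * Suc n * \<bar>\<phi> j x - \<phi> j (U t x)\<bar>"
      by (simp add: abs_mult flip: right_diff_distrib)
    moreover have "2 \<le> 2 * Suc n * \<bar>\<phi> j x - \<phi> j (U t x)\<bar>"
      using j(2) by (simp add: field_simps)
    ultimately show False
      by simp
  qed
  have "AE x in M. \<forall>t. t \<noteq> 0 \<longrightarrow> (\<exists>A\<in>C. \<exists>a\<in>rational_points. \<exists>b\<in>rational_points.
           sojourn A a b x \<noteq> sojourn A a b (U t x))"
    by (rule AE_sojourn_separates_orbit[OF aper N C]) (rule sep[rule_format])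
  with AE_space have cover: "AE x in M. x \<in> (\<Union>p. D p)"
  proof eventually_elim
    case (elim x)
    have sep_x: "\<exists>j. \<phi> j x \<noteq> \<phi> j (U t x)" if t: "t \<in> K" for t
    proof -
      have "t \<noteq> 0" using t K(2) by auto
      then obtain A a b where Aab: "A \<in> C" "a \<in> rational_points" "b \<in> rational_points"
          "sojourn A a b x \<noteq> sojourn A a b (U t x)"
        using elim(2) by blast
      then have "(A, a, b) \<in> range e"
        by (simp add: e I_def)
      then obtain j where "e j = (A, a, b)" by auto
      then have "\<phi> j x \<noteq> \<phi> j (U t x)"
        using Aab(4) by (simp add: \<phi>_def)
      then show ?thesis ..
    qed
    define G where "G m = {t. \<exists>j<m. 1 / Suc m < \<bar>\<phi> j x - \<phi> j (U t x)\<bar>}" for m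
    have open_G: "open (G m)" if "m \<in> UNIV" for m
    proof -
      have "G m = (\<Union>j<m. {t. 1 / Suc m < \<bar>\<phi> j x - \<phi> j (U t x)\<bar>})"
        by (auto simp: G_def)
      moreover have "open {t. 1 / Suc m < \<bar>\<phi> j x - \<phi> j (U t x)\<bar>}" for j
        by (intro open_Collect_less continuous_intros cont elim)
      ultimately show ?thesis
        by auto
    qed
    have cover_G: "K \<subseteq> (\<Union>m\<in>UNIV. G m)"
    proof
      fix t assume "t \<in> K"
      then obtain j where "\<bar>\<phi> j x - \<phi> j (U t x)\<bar> > 0"
        using sep_x by fastforce
      then obtain m0 where m0: "1 / Suc m0 < \<bar>\<phi> j x - \<phi> j (U t x)\<bar>"
        using nat_approx_posE by metis
      have "1 / Suc (m0 + Suc j) \<le> 1 / Suc m0"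
        by (intro divide_left_mono) auto
      then have "t \<in> G (m0 + Suc j)"
        using m0 unfolding G_def by (intro CollectI exI[of _ j]) linarith
      then show "t \<in> (\<Union>m. G m)" by blast
    qed
    obtain F where F: "finite F" "K \<subseteq> (\<Union>m\<in>F. G m)"
      by (rule compactE_image[OF K(1) open_G cover_G])
    define n where "n = Max (insert 0 F)"
    have G_mono: "G m \<subseteq> G n" if "m \<in> F" for m
    proof
      have "m \<le> n" using F(1) that by (simp add: n_def)
      then have "1 / Suc n \<le> 1 / Suc m"
        by (intro divide_left_mono) auto
      fix t assume "t \<in> G m"
      then obtain j where "j < m" "1 / Suc m < \<bar>\<phi> j x - \<phi> j (U t x)\<bar>"
        by (auto simp: G_def)
      then show "t \<in> G n"
        using \<open>m \<le> n\<close> \<open>1 / Suc n \<le> 1 / Suc m\<close> unfolding G_def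
        by (intro CollectI exI[of _ j]) linarith
    qed
    have "gap n t x" if "t \<in> K0" for t
    proof -
      have "t \<in> G n"
        using that F(2) G_mono K0(2) by blast
      then show ?thesis
        unfolding G_def gap_def by (auto intro: less_imp_le)
    qed
    then have "x \<in> D (n, map (\<lambda>j. \<lfloor>2 * Suc n * \<phi> j x\<rfloor>) [0..<n])"
      using elim(1) by (simp add: D_def)
    then show ?case by blast
  qed
  have "\<exists>p. emeasure M (D p) > 0"
  proof (rule ccontr)
    assume "\<nexists>p. emeasure M (D p) > 0"
    then have "emeasure M (D p) = 0" for p
      by (meson not_gr_zero)
    then have "D p \<in> null_sets M" for p
      using D_sets by (intro null_setsI)
    then have "(\<Union>p. D p) \<in> null_sets M"
      by (intro null_sets_UN)
    from AE_not_in[OF this] cover have "AE x in M. False"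
      by eventually_elim simp
    then show False
      by simp
  qed
  then show thesis
    using that D_sets D_avoids by blast
qed

end

section \<open>Transferring regions of time to sets of points\<close>

text \<open>
  The cube has side \<open>2\<close> so that, for any two points \<open>v\<close> and \<open>w\<close> of one cell of the integer lattice, \<open>w - v\<close>
  lies in it.
\<close>

definition unit_cube :: "(real ^ 'd::finite) set" where
  "unit_cube = {e. \<forall>j. e $ j \<in> {- 1..1}}"

lemma unit_cube_borel [measurable]: "unit_cube \<in> sets borel"
  unfolding unit_cube_def by measurable

definition union_of_lattice_cells :: "(real ^ 'd::finite) set \<Rightarrow> bool" where
  "union_of_lattice_cells P \<longleftrightarrow> (\<forall>u\<in>P. \<forall>v. (\<forall>j. \<lfloor>v $ j\<rfloor> = \<lfloor>u $ j\<rfloor>) \<longrightarrow> v \<in> P)"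

context mp_flow begin

text \<open>
  Let \<open>D\<close> be a set to which no orbit returns at a time of norm at most \<open>R\<close> outside the open cube
  \<open>(-1, 1)\<^sup>d\<close>, and let \<open>D1\<close> be \<open>D\<close> thickened by the unit cube in the time direction. Its measure \<open>\<theta>\<close> serves as the
  unit. If an orbit visits \<open>D\<close> during \<open>P\<close> for a positive time, it does so during some lattice cell contained
  in \<open>P\<close>, and then it spends that whole cell in \<open>D1\<close>: this bounds \<open>\<mu> E\<close> above by \<open>|P| \<theta>\<close>. Conversely the times
  in \<open>V\<close> at which an orbit is in \<open>D1\<close> all lie in one cube of side \<open>6\<close>, since the corresponding visits to \<open>D\<close>
  are close together: this bounds \<open>\<mu> F\<close> below by \<open>|V| \<theta> / 6\<^sup>d\<close>.
\<close>

lemma ex_tower: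
  assumes aper: "aperiodic_flow M U" and cs: "countably_separated_ae M"
    and V: "bounded V" "V \<in> sets borel"
    and P: "P \<in> sets borel" "union_of_lattice_cells P"
  obtains E F \<theta> where "E \<in> sets M" "F \<in> sets M" "\<theta> > 0"
    "emeasure M E \<le> emeasure lborel P * \<theta>"
    "emeasure lborel V * \<theta> \<le> 6 ^ CARD('d) * emeasure M F"
    "\<And>x. x \<in> F \<Longrightarrow> \<exists>v\<in>V. \<forall>t. (\<forall>e\<in>unit_cube. v + e - t \<in> P) \<longrightarrow> U t x \<in> E"
proof -
  have [measurable]: "V \<in> sets borel" "P \<in> sets borel" using V P by auto
  obtain B where B: "\<And>v. v \<in> V \<Longrightarrow> norm v \<le> B"
    using V(1) by (auto simp: bounded_iff)
  have norm_cube: "norm e \<le> CARD('d)" if "e \<in> unit_cube" for e :: "real ^ 'd"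
  proof -
    have "norm e \<le> (\<Sum>j\<in>UNIV. \<bar>e $ j\<bar>)"
      by (rule norm_le_l1_cart)
    also have "\<dots> \<le> (\<Sum>j\<in>(UNIV :: 'd set). 1)"
      using that by (intro sum_mono) (auto simp: unit_cube_def abs_le_iff)
    finally show ?thesis by simp
  qed
  \<comment> \<open>two visits to \<open>D\<close>, each within the unit cube of a time in \<open>V\<close>, are at most \<open>R\<close> apart in norm\<close>
  define R where "R = 2 * B + 2 * real CARD('d)"
  define K :: "(real ^ 'd) set" where "K = cball 0 R - (\<Inter>j. {z. \<bar>z $ j\<bar> < 1})"
  have "compact K"
    unfolding K_def
    by (intro compact_diff compact_cball open_INT finite ballI open_Collect_less continuous_intros)
  moreover have "0 \<notin> K"
    by (simp add: K_def)
  ultimately obtain D where D: "D \<in> sets M" "emeasure M D > 0"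
    and D_avoids: "\<And>x t. x \<in> D \<Longrightarrow> t \<in> K \<Longrightarrow> U t x \<notin> D"
    using ex_positive_set_avoiding_compact_times[OF aper cs] by metis
  have [measurable]: "D \<in> sets M" by (rule D)
  define D1 where "D1 = {x\<in>space M. 0 < occupation unit_cube D x}"
  define E where "E = {x\<in>space M. 0 < occupation P D x}"
  define F where "F = {x\<in>space M. 0 < occupation V D1 x}"
  have [measurable]: "D1 \<in> sets M"
    unfolding D1_def by measurable
  have [measurable]: "E \<in> sets M" "F \<in> sets M"
    unfolding E_def F_def by measurable
  have D1_iff: "U v x \<in> D1 \<longleftrightarrow> 0 < emeasure lborel ({w. w - v \<in> unit_cube} \<inter> visits D x)"
    if "x \<in> space M" for v x
    using that by (simp add: D1_def occupation_flow)
  have visits_D [measurable]: "visits D x \<in> sets borel" "visits D1 x \<in> sets borel" if "x \<in> space M" for x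
    using that by simp_all

  show thesis
  proof (rule that[of E F "emeasure M D1"])
    show "emeasure M D1 > 0"
    proof (rule ccontr)
      assume "\<not> emeasure M D1 > 0"
      then have "D1 \<in> null_sets M"
        by (intro null_setsI) auto
      from AE_not_in[OF this] AE_space have "AE x in M. occupation unit_cube D x = 0"
        by eventually_elim (auto simp: D1_def)
      then have "(\<integral>\<^sup>+x. occupation unit_cube D x \<partial>M) = 0"
        by (subst nn_integral_0_iff_AE) auto
      moreover have "emeasure lborel (unit_cube :: (real ^ 'd) set) = 2 ^ CARD('d)"
        using emeasure_lborel_vec_cube(1)[of 2 "\<lambda>_::'d. - 1"] by (simp add: unit_cube_def)
      ultimately show False
        using D(2) by (simp add: nn_integral_occupation)
    qed
  next
    \<comment> \<open>integrated over \<open>x\<close>, this gives the bound on \<open>\<mu> E\<close>\<close>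
    have "indicator E x \<le> occupation P D1 x" if x: "x \<in> space M" for x
    proof (cases "x \<in> E")
      case True
      note visits_D[OF x, measurable]
      define cell where "cell n = {u :: real ^ 'd. \<forall>j. u $ j \<in> {of_int (n j)..<of_int (n j) + 1}}" for n :: "'d \<Rightarrow> int"
      have cell_floor: "u \<in> cell n \<longleftrightarrow> (\<forall>j. \<lfloor>u $ j\<rfloor> = n j)" for u n
        by (auto simp: cell_def floor_eq_iff)
      have [measurable]: "cell n \<in> sets borel" for n
        unfolding cell_def by measurable
      have "\<exists>n. emeasure lborel (cell n \<inter> (P \<inter> visits D x)) \<noteq> 0"
      proof (rule ccontr)
        assume "\<nexists>n. emeasure lborel (cell n \<inter> (P \<inter> visits D x)) \<noteq> 0"
        then have "(\<Union>n. cell n \<inter> (P \<inter> visits D x)) \<in> null_sets lborel"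
          by (intro null_sets_UN null_setsI) auto
        moreover have "(\<Union>n. cell n \<inter> (P \<inter> visits D x)) = P \<inter> visits D x"
          by (auto simp: cell_floor)
        ultimately show False
          using True by (auto simp: E_def occupation_def)
      qed
      then obtain n where n: "emeasure lborel (cell n \<inter> (P \<inter> visits D x)) > 0"
        by (auto simp: zero_less_iff_neq_zero)
      then obtain u where "u \<in> cell n" "u \<in> P"
        by (metis Int_iff all_not_in_conv emeasure_empty less_irrefl)
      then have cell_P: "cell n \<subseteq> P"
        using P(2) by (auto simp: cell_floor union_of_lattice_cells_def)
      have "v \<in> visits D1 x" if v: "v \<in> cell n" for v
      proof -
        have "w - v \<in> unit_cube" if "w \<in> cell n" for w
          unfolding unit_cube_def
        proof (intro CollectI allI)
          fix j show "(w - v) $ j \<in> {-1..1}"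
            using v that by (force simp: cell_def dest!: spec[of _ j])
        qed
        then have "emeasure lborel (cell n \<inter> (P \<inter> visits D x)) \<le> emeasure lborel ({w. w - v \<in> unit_cube} \<inter> visits D x)"
          by (intro emeasure_mono) auto
        with n have "U v x \<in> D1"
          by (subst D1_iff[OF x]) (rule less_le_trans)
        then show ?thesis
          by (simp add: visits_def)
      qed
      then have "cell n \<subseteq> P \<inter> visits D1 x"
        using cell_P by auto
      then have "emeasure lborel (cell n) \<le> occupation P D1 x"
        unfolding occupation_def by (intro emeasure_mono) auto
      moreover have "emeasure lborel (cell n) = 1"
        using emeasure_lborel_vec_cube(2)[of 1 "\<lambda>j. of_int (n j)"] by (simp add: cell_def)
      ultimately show ?thesis
        using True by simp
    qed simp
    then have "(\<integral>\<^sup>+x. indicator E x \<partial>M) \<le> (\<integral>\<^sup>+x. occupation P D1 x \<partial>M)"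
      by (rule nn_integral_mono)
    then show "emeasure M E \<le> emeasure lborel P * emeasure M D1"
      by (simp add: nn_integral_occupation)
  next
    have "occupation V D1 x \<le> 6 ^ CARD('d) * indicator F x" if x: "x \<in> space M" for x
    proof (cases "x \<in> F")
      case True
      note visits_D[OF x, measurable]
      have ex_D: "\<exists>z\<in>visits D x. z - u \<in> unit_cube" if "u \<in> visits D1 x" for u
      proof -
        have "{w. w - u \<in> unit_cube} \<inter> visits D x \<noteq> {}"
          using that D1_iff[OF x, of u] by (metis emeasure_empty less_irrefl mem_Collect_eq visits_def)
        then show ?thesis by auto
      qed
      obtain u0 where u0: "u0 \<in> V" "u0 \<in> visits D1 x"
        using True by (metis (mono_tags, lifting) F_def Int_iff all_not_in_conv emeasure_empty less_irrefl mem_Collect_eq occupation_def)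
      obtain z0 where z0: "z0 \<in> visits D x" "z0 - u0 \<in> unit_cube"
        using ex_D[OF u0(2)] by auto
      \<comment> \<open>\<open>3 = 1 + 1 + 1\<close>: from \<open>u\<close> to a visit of \<open>D\<close>, on to the visit of \<open>D\<close> near \<open>u0\<close>, and back to \<open>u0\<close>\<close>
      have "V \<inter> visits D1 x \<subseteq> {u. \<forall>j. u $ j \<in> {u0 $ j - 3..u0 $ j - 3 + 6}}"
      proof (intro subsetI CollectI allI)
        fix u j assume u: "u \<in> V \<inter> visits D1 x"
        then obtain z where z: "z \<in> visits D x" "z - u \<in> unit_cube"
          using ex_D by auto
        have "U (z - z0) (U z0 x) \<in> D"
          using z(1) flow_add[OF x, of "z - z0" z0] by (simp add: visits_def)
        then have "z - z0 \<notin> K"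
          using D_avoids[of "U z0 x" "z - z0"] z0(1) by (auto simp: visits_def)
        moreover have "norm (z - z0) \<le> R"
        proof -
          have "z - z0 = (z - u) - (z0 - u0) + (u - u0)"
            by simp
          also have "norm \<dots> \<le> norm (z - u) + norm (z0 - u0) + (norm u + norm u0)"
            by (meson add_mono norm_triangle_ineq norm_triangle_ineq4 order_trans)
          also have "\<dots> \<le> R"
            using norm_cube[OF z(2)] norm_cube[OF z0(2)] B[of u] B[of u0] u u0 by (simp add: R_def)
          finally show ?thesis .
        qed
        ultimately have "\<bar>z $ j - z0 $ j\<bar> < 1"
          by (auto simp: K_def)
        moreover have "\<bar>z $ j - u $ j\<bar> \<le> 1" "\<bar>z0 $ j - u0 $ j\<bar> \<le> 1"
          using z(2) z0(2) by (auto simp: unit_cube_def abs_le_iff dest!: spec[of _ j])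
        ultimately show "u $ j \<in> {u0 $ j - 3..u0 $ j - 3 + 6}"
          by auto
      qed
      then have "occupation V D1 x \<le> emeasure lborel {u :: real ^ 'd. \<forall>j. u $ j \<in> {u0 $ j - 3..u0 $ j - 3 + 6}}"
        unfolding occupation_def by (rule emeasure_mono) measurable
      also have "\<dots> = 6 ^ CARD('d)"
        using emeasure_lborel_vec_cube(1)[of 6 "\<lambda>j. u0 $ j - 3"] by simp
      finally show ?thesis
        using True by simp
    qed (use x in \<open>simp add: F_def\<close>)
    then have "(\<integral>\<^sup>+x. occupation V D1 x \<partial>M) \<le> (\<integral>\<^sup>+x. 6 ^ CARD('d) * indicator F x \<partial>M)"
      by (rule nn_integral_mono)
    then show "emeasure lborel V * emeasure M D1 \<le> 6 ^ CARD('d) * emeasure M F"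
      by (simp add: nn_integral_occupation nn_integral_cmult)
  next
    fix x assume "x \<in> F"
    then have x: "x \<in> space M" and "V \<inter> visits D1 x \<noteq> {}"
      by (auto simp: F_def occupation_def)
    then obtain v where v: "v \<in> V" "U v x \<in> D1"
      by (auto simp: visits_def)
    note visits_D[OF x, measurable]
    show "\<exists>v\<in>V. \<forall>t. (\<forall>e\<in>unit_cube. v + e - t \<in> P) \<longrightarrow> U t x \<in> E"
    proof (intro bexI[OF _ v(1)] allI impI)
      fix t assume t: "\<forall>e\<in>unit_cube. v + e - t \<in> P"
      have "{w. w - v \<in> unit_cube} \<subseteq> {w. w - t \<in> P}"
        using t by (auto dest!: bspec)
      then have "emeasure lborel ({w. w - v \<in> unit_cube} \<inter> visits D x) \<le> occupation P D (U t x)"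
        using x by (subst occupation_flow) (auto intro!: emeasure_mono)
      then show "U t x \<in> E"
        using v(2) x unfolding E_def D1_iff[OF x] by (auto intro: less_le_trans)
    qed
  qed auto
qed

end

section \<open>Regions swept by the boxes\<close>

text \<open>
  The section of the cone set is a union of intervals of length at most \<open>2 y\<close>, so dropping the first \<open>N\<close> of
  them costs at most \<open>2 N y\<close>; continuity from below then allows to stop at a finite index.
  The remaining loss of \<open>y\<close> makes room for passing from the supremum to a member of the sequence.
\<close>

lemma ex_finite_union_large:
  fixes w s :: "nat \<Rightarrow> real"
  assumes large: "emeasure lborel (cone_section {(w k, s k) |k. True} 1 y) \<ge> ennreal (A * y)"
    and y: "y > 0" and s: "\<And>k. s k > 0" and A: "A \<ge> 2 * real N + 1"
  obtains K where "emeasure lborel (\<Union>k\<in>{N..K}. {w k - (y - s k)..w k + (y - s k)})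
      \<ge> ennreal ((A - 2 * real N - 1) * y)"
proof -
  define J where "J k = {w k - (y - s k)..w k + (y - s k)}" for k
  define T where "T K = (\<Union>k\<in>{N..K}. J k)" for K
  have J_le: "emeasure lborel (J k) \<le> ennreal (2 * y)" for k
    using s[of k] y unfolding J_def by (cases "s k \<le> y") (auto intro!: ennreal_leI)
  have [measurable]: "J k \<in> sets borel" "T K \<in> sets borel" for k K
    unfolding J_def T_def by auto
  have "\<exists>K. emeasure lborel (T K) \<ge> ennreal ((A - 2 * real N - 1) * y)"
  proof (rule ccontr)
    assume "\<not> ?thesis"
    then have small: "emeasure lborel (T K) \<le> ennreal ((A - 2 * real N - 1) * y)" for K
      by (meson le_cases)
    have "v \<in> cone_section {(w k, s k) |k. True} 1 y \<longleftrightarrow> (\<exists>k. \<bar>v - w k\<bar> \<le> y - s k)" for v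
      using y unfolding cone_section_def cone_set_def by fastforce
    moreover have "v \<in> J k \<longleftrightarrow> \<bar>v - w k\<bar> \<le> y - s k" for v k
      by (auto simp: J_def abs_le_iff)
    ultimately have "cone_section {(w k, s k) |k. True} 1 y = (\<Union>k. J k)"
      by auto
    also have "\<dots> \<subseteq> (\<Union>k<N. J k) \<union> (\<Union>K. T K)"
    proof
      fix v assume "v \<in> (\<Union>k. J k)"
      then obtain k where "v \<in> J k" by auto
      then show "v \<in> (\<Union>k<N. J k) \<union> (\<Union>K. T K)"
        by (cases "k < N") (auto simp: T_def not_less intro!: exI[of _ k])
    qed
    finally have "ennreal (A * y) \<le> emeasure lborel ((\<Union>k<N. J k) \<union> (\<Union>K. T K))"
      by (intro order_trans[OF large] emeasure_mono) auto
    also have "\<dots> \<le> emeasure lborel (\<Union>k<N. J k) + emeasure lborel (\<Union>K. T K)"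
      by (intro emeasure_subadditive) auto
    also have "\<dots> \<le> ennreal (2 * real N * y) + ennreal ((A - 2 * real N - 1) * y)"
    proof (rule add_mono)
      have "emeasure lborel (\<Union>k<N. J k) \<le> (\<Sum>k<N. emeasure lborel (J k))"
        by (intro emeasure_subadditive_finite) auto
      also have "\<dots> \<le> (\<Sum>k<N. ennreal (2 * y))"
        by (intro sum_mono J_le)
      also have "\<dots> = ennreal (2 * real N * y)"
        using y by (simp add: ennreal_of_nat_eq_real_of_nat mult_ac flip: ennreal_mult)
      finally show "emeasure lborel (\<Union>k<N. J k) \<le> ennreal (2 * real N * y)" .
      have "incseq T"
        unfolding T_def incseq_def by (intro allI impI UN_mono) auto
      then have "emeasure lborel (\<Union>K. T K) = (SUP K. emeasure lborel (T K))"
        by (intro SUP_emeasure_incseq[symmetric]) auto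
      also have "\<dots> \<le> ennreal ((A - 2 * real N - 1) * y)"
        by (intro SUP_least small)
      finally show "emeasure lborel (\<Union>K. T K) \<le> ennreal ((A - 2 * real N - 1) * y)" .
    qed
    also have "\<dots> = ennreal (2 * real N * y + (A - 2 * real N - 1) * y)"
      using y A by (intro ennreal_plus[symmetric] mult_nonneg_nonneg) auto
    also have "\<dots> = ennreal ((A - 1) * y)"
      by (simp add: algebra_simps)
    finally show False
      using y A by (subst (asm) ennreal_le_iff) (auto simp: algebra_simps)
  qed
  then show thesis
    using that by (auto simp: T_def J_def)
qed

text \<open>
  In direction \<open>i\<close>, \<open>V\<close> is the union \<open>S\<close> of the intervals and \<open>P\<close> is essentially \<open>[-y, y]\<close>. In each other
  direction \<open>V\<close> is an interval of length \<open>L\<close> and \<open>P\<close> exceeds it on both sides by \<open>c + 1\<close>, where \<open>c\<close> bounds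
  the boxes in use and \<open>1\<close> absorbs the unit cube; the choice \<open>L = 2 c + 2\<close> makes this a doubling of the
  length.
\<close>

lemma ex_swept_region:
  fixes w s :: "nat \<Rightarrow> real ^ 'd" and i :: 'd
  assumes s: "\<And>k j. s k $ j > 0" and C: "C > 0"
    and large: "\<And>A \<alpha>. A > 0 \<Longrightarrow> \<alpha> > 0 \<Longrightarrow>
           \<not> bdd_above {y. y > 0 \<and> emeasure lborel (cone_section (Omega w s i) \<alpha> y) \<ge> ennreal (A * y)}"
  obtains K V P where "bounded V" "V \<in> sets borel" "emeasure lborel V > 0" "P \<in> sets borel"
    "union_of_lattice_cells P"
    "ennreal C * emeasure lborel P \<le> emeasure lborel V"
    "\<And>v. v \<in> V \<Longrightarrow> \<exists>k\<in>{N..K}. \<forall>t\<in>avg_box (w k) (s k). \<forall>e\<in>unit_cube. v + e - t \<in> P"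
proof -
  define n where "n = CARD('d) - 1"
  \<comment> \<open>\<open>2 N + 1\<close> is lost in the preceding lemma; \<open>P\<close> has the measure \<open>2 \<lceil>y\<rceil> + 3 \<le> 7 y\<close> in direction \<open>i\<close> and
    doubles the length in the \<open>n\<close> other directions\<close>
  define A where "A = 2 * real N + 1 + 7 * 2 ^ n * C"
  have A: "A > 0" "A \<ge> 2 * real N + 1"
    using C by (auto simp: A_def add_pos_pos)
  obtain y where y: "y > 1"
    and y_large: "emeasure lborel (cone_section {(w k $ i, s k $ i) |k. True} 1 y) \<ge> ennreal (A * y)"
  proof -
    have "\<not> (\<forall>y\<in>{y. y > 0 \<and> emeasure lborel (cone_section (Omega w s i) 1 y) \<ge> ennreal (A * y)}. y \<le> 1)"
      using large[OF A(1), of 1] unfolding bdd_above_def by auto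
    then show thesis
      using that by (auto simp: not_le Omega_def)
  qed
  obtain K where "emeasure lborel (\<Union>k\<in>{N..K}. {w k $ i - (y - s k $ i)..w k $ i + (y - s k $ i)})
      \<ge> ennreal ((A - 2 * real N - 1) * y)"
    using ex_finite_union_large[OF y_large _ s A(2)] y by (metis less_trans zero_less_one)
  moreover define S where "S = (\<Union>k\<in>{N..K}. {w k $ i - (y - s k $ i)..w k $ i + (y - s k $ i)})"
  ultimately have S_large: "emeasure lborel S \<ge> ennreal (7 * 2 ^ n * C * y)"
    by (simp add: A_def)
  have S_borel [measurable]: "S \<in> sets borel"
    by (auto simp: S_def)
  have "bounded S"
    unfolding S_def by (intro bounded_UN) auto
  then obtain bS where bS: "\<And>x. x \<in> S \<Longrightarrow> \<bar>x\<bar> \<le> bS"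
    by (auto simp: bounded_iff)
  define m where "m = (\<Sum>k\<le>K. \<Sum>j\<in>UNIV. \<bar>w k $ j\<bar> + \<bar>s k $ j\<bar>)"
  have m: "\<bar>w k $ j\<bar> + \<bar>s k $ j\<bar> \<le> m" if "k \<le> K" for k j
  proof -
    have "\<bar>w k $ j\<bar> + \<bar>s k $ j\<bar> \<le> (\<Sum>j\<in>UNIV. \<bar>w k $ j\<bar> + \<bar>s k $ j\<bar>)"
      by (rule member_le_sum) auto
    also have "\<dots> \<le> m"
      unfolding m_def using that by (intro member_le_sum) (auto intro!: sum_nonneg)
    finally show ?thesis .
  qed
  have "m \<ge> 0"
    unfolding m_def by (intro sum_nonneg) auto
  define c L :: int where "c = \<lceil>m\<rceil>" and "L = 2 * c + 2"
  have c: "m \<le> of_int c" "c \<ge> 0"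
    using \<open>m \<ge> 0\<close> by (auto simp: c_def)
  define V :: "(real ^ 'd) set" where "V = {u. \<forall>j. u $ j \<in> (if j = i then S else {0..<of_int L})}"
  define lo hi :: "'d \<Rightarrow> int" where
    "lo j = (if j = i then - \<lceil>y\<rceil> - 1 else - c - 1)" and "hi j = (if j = i then \<lceil>y\<rceil> + 2 else L + c + 1)" for j
  define P :: "(real ^ 'd) set" where "P = {u. \<forall>j. u $ j \<in> {of_int (lo j)..<of_int (hi j)}}"
  have emeasure_V: "emeasure lborel V = emeasure lborel S * ennreal (of_int L) ^ n"
  proof -
    have "emeasure lborel V = (\<Prod>j\<in>UNIV. emeasure lborel (if j = i then S else {0..<of_int L}))"
      unfolding V_def by (rule emeasure_lborel_vec_product) auto
    also have "\<dots> = (\<Prod>j\<in>UNIV. if j = i then emeasure lborel S else ennreal (of_int L))"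
      using c(2) by (intro prod.cong) (auto simp: L_def)
    finally show ?thesis
      by (simp only: prod_if_one n_def)
  qed
  have emeasure_P: "emeasure lborel P = ennreal (2 * of_int \<lceil>y\<rceil> + 3) * ennreal (2 * of_int L) ^ n"
  proof -
    have "emeasure lborel P = (\<Prod>j\<in>UNIV. emeasure lborel {real_of_int (lo j)..<of_int (hi j)})"
      unfolding P_def by (rule emeasure_lborel_vec_product) auto
    also have "\<dots> = (\<Prod>j\<in>UNIV. if j = i then ennreal (2 * of_int \<lceil>y\<rceil> + 3) else ennreal (2 * of_int L))"
      using c(2) y by (intro prod.cong) (auto simp: lo_def hi_def L_def intro!: arg_cong[where f=ennreal])
    finally show ?thesis
      by (simp only: prod_if_one n_def)
  qed
  have "L \<ge> 0"
    using c(2) by (simp add: L_def)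
  have pow_L: "ennreal (of_int L) ^ n = ennreal (of_int L ^ n)"
    "ennreal (2 * of_int L) ^ n = ennreal ((2 * of_int L) ^ n)"
    using \<open>L \<ge> 0\<close> by (intro ennreal_power; simp)+
  have S_pos: "emeasure lborel S > 0"
    using C y by (intro less_le_trans[OF _ S_large]) simp
  show thesis
  proof (rule that[of V P K])
    show "bounded V"
      unfolding bounded_iff
    proof (intro exI ballI)
      fix u assume u: "u \<in> V"
      have "norm u \<le> (\<Sum>j\<in>UNIV. \<bar>u $ j\<bar>)"
        by (rule norm_le_l1_cart)
      also have "\<dots> \<le> (\<Sum>j\<in>(UNIV :: 'd set). max bS (of_int L))"
      proof (rule sum_mono)
        fix j show "\<bar>u $ j\<bar> \<le> max bS (of_int L)"
          using u bS[of "u $ j"] by (auto simp: V_def dest!: spec[of _ j] split: if_splits)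
      qed
      finally show "norm u \<le> (\<Sum>j\<in>(UNIV :: 'd set). max bS (of_int L))" .
    qed
    have [measurable]: "(if j = i then S else {0..<real_of_int L}) \<in> sets borel" for j
      by simp
    have "V = (\<Inter>j. (\<lambda>u. u $ j) -` (if j = i then S else {0..<of_int L}) \<inter> space borel)"
      unfolding V_def
      by (intro set_eqI) (simp only: mem_Collect_eq INT_iff Int_iff vimage_eq space_borel simp_thms ball_UNIV UNIV_I)
    also have "\<dots> \<in> sets borel"
      by (intro sets.finite_INT measurable_sets[where A=borel]) auto
    finally show "V \<in> sets borel" .
    show "emeasure lborel V > 0"
      using S_pos c(2) by (simp add: emeasure_V pow_L ennreal_zero_less_mult_iff) (simp add: L_def)
    show "P \<in> sets borel"
      unfolding P_def by measurable
    have "u \<in> P \<longleftrightarrow> (\<forall>j. lo j \<le> \<lfloor>u $ j\<rfloor> \<and> \<lfloor>u $ j\<rfloor> < hi j)" for u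
      by (simp add: P_def le_floor_iff floor_less_iff)
    then show "union_of_lattice_cells P"
      by (simp add: union_of_lattice_cells_def)
    show "ennreal C * emeasure lborel P \<le> emeasure lborel V"
    proof -
      have "2 * of_int \<lceil>y\<rceil> + 3 \<le> 7 * y"
        using y of_int_ceiling_le_add_one[of y] by linarith
      then have "C * ((2 * of_int \<lceil>y\<rceil> + 3) * (2 * of_int L) ^ n) \<le> C * ((7 * y) * (2 * of_int L) ^ n)"
        using C c(2) by (intro mult_left_mono mult_right_mono) (auto simp: L_def)
      also have "\<dots> = 7 * 2 ^ n * C * y * of_int L ^ n"
        by (simp add: power_mult_distrib)
      finally have "ennreal (C * ((2 * of_int \<lceil>y\<rceil> + 3) * (2 * of_int L) ^ n)) \<le> ennreal (7 * 2 ^ n * C * y * of_int L ^ n)"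
        by (rule ennreal_leI)
      also have "\<dots> = ennreal (7 * 2 ^ n * C * y) * ennreal (of_int L) ^ n"
        unfolding pow_L using C y \<open>L \<ge> 0\<close> by (intro ennreal_mult) auto
      also have "\<dots> \<le> emeasure lborel V"
        unfolding emeasure_V by (intro mult_right_mono S_large) simp
      also have "ennreal (C * ((2 * of_int \<lceil>y\<rceil> + 3) * (2 * of_int L) ^ n)) = ennreal C * emeasure lborel P"
      proof -
        have "0 \<le> C" "0 \<le> 2 * real_of_int \<lceil>y\<rceil> + 3" "0 \<le> (2 * real_of_int L) ^ n"
          using C y \<open>L \<ge> 0\<close> by auto
        then show ?thesis
          unfolding emeasure_P pow_L by (simp only: ennreal_mult mult_nonneg_nonneg)
      qed
      finally show ?thesis .
    qed
    show "\<exists>k\<in>{N..K}. \<forall>t\<in>avg_box (w k) (s k). \<forall>e\<in>unit_cube. v + e - t \<in> P" if v: "v \<in> V" for v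
    proof -
      have "v $ i \<in> S"
        using v by (auto simp: V_def dest!: spec[of _ i])
      then obtain k where k: "k \<in> {N..K}" "\<bar>v $ i - w k $ i\<bar> \<le> y - s k $ i"
        by (auto simp: S_def abs_le_iff)
      show ?thesis
      proof (intro bexI[OF _ k(1)] ballI)
        fix t e assume t: "t \<in> avg_box (w k) (s k)" and e: "e \<in> (unit_cube :: (real ^ 'd) set)"
        have "(v + e - t) $ j \<in> {of_int (lo j)..<of_int (hi j)}" for j
        proof -
          have tj: "w k $ j \<le> t $ j" "t $ j < w k $ j + s k $ j"
            using t by (auto simp: avg_box_def)
          have ej: "- 1 \<le> e $ j" "e $ j \<le> 1"
            using e by (auto simp: unit_cube_def)
          show ?thesis
          proof (cases "j = i")
            case True
            have "y \<le> real_of_int \<lceil>y\<rceil>" by simp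
            then have "- real_of_int \<lceil>y\<rceil> - 1 \<le> v $ j + e $ j - t $ j"
              "v $ j + e $ j - t $ j < real_of_int \<lceil>y\<rceil> + 2"
              using k(2) tj ej unfolding True by linarith+
            then show ?thesis
              using True by (simp add: lo_def hi_def)
          next
            case False
            then have "0 \<le> v $ j" "v $ j < of_int L"
              using v by (auto simp: V_def dest!: spec[of _ j])
            moreover have "\<bar>w k $ j\<bar> + \<bar>s k $ j\<bar> \<le> of_int c"
              using m[of k j] k(1) c(1) by auto
            ultimately have "- real_of_int c - 1 \<le> v $ j + e $ j - t $ j"
              "v $ j + e $ j - t $ j < real_of_int L + real_of_int c + 1"
              using tj ej s[of k j] by linarith+
            then show ?thesis
              using False by (simp add: lo_def hi_def)
          qed
        qed
        then show "v + e - t \<in> P"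
          unfolding P_def by blast
      qed
    qed
  qed
qed

context mp_flow begin

text \<open>
  If \<open>x\<close> meets the base of the tower at a time \<open>v \<in> V\<close>, then \<open>U t x\<close> meets it at time \<open>v - t\<close>, which is in
  \<open>P\<close> for all \<open>t\<close> in a suitable box. The factor \<open>6\<^sup>d\<close> lost in the tower is made up for by asking for a
  region that is better by this factor.
\<close>

lemma ex_swept_set:
  fixes w s :: "nat \<Rightarrow> real ^ 'd" and i :: 'd
  assumes aper: "aperiodic_flow M U" and cs: "countably_separated_ae M"
    and s: "\<And>k j. s k $ j > 0" and C: "C > 0"
    and large: "\<And>A \<alpha>. A > 0 \<Longrightarrow> \<alpha> > 0 \<Longrightarrow>
           \<not> bdd_above {y. y > 0 \<and> emeasure lborel (cone_section (Omega w s i) \<alpha> y) \<ge> ennreal (A * y)}"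
  obtains E F K where "E \<in> sets M" "F \<in> sets M" "measure M F > 0" "C * measure M E \<le> measure M F"
    "\<And>x. x \<in> F \<Longrightarrow> \<exists>k\<in>{N..K}. \<forall>t\<in>avg_box (w k) (s k). U t x \<in> E"
proof -
  have C6: "C * 6 ^ CARD('d) > 0"
    using C by simp
  obtain K V P where VP: "bounded V" "V \<in> sets borel" "emeasure lborel V > 0" "P \<in> sets borel"
    "union_of_lattice_cells P"
    "ennreal (C * 6 ^ CARD('d)) * emeasure lborel P \<le> emeasure lborel V"
    and swept: "\<And>v. v \<in> V \<Longrightarrow> \<exists>k\<in>{N..K}. \<forall>t\<in>avg_box (w k) (s k). \<forall>e\<in>unit_cube. v + e - t \<in> P"
    by (rule ex_swept_region[where w=w and s=s and i=i and N=N, OF s C6 large])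
      (assumption | rule that)+
  obtain E F \<theta> where EF: "E \<in> sets M" "F \<in> sets M" and \<theta>: "\<theta> > 0"
    "emeasure M E \<le> emeasure lborel P * \<theta>"
    "emeasure lborel V * \<theta> \<le> 6 ^ CARD('d) * emeasure M F"
    and F: "\<And>x. x \<in> F \<Longrightarrow> \<exists>v\<in>V. \<forall>t. (\<forall>e\<in>unit_cube. v + e - t \<in> P) \<longrightarrow> U t x \<in> E"
    by (rule ex_tower[OF aper cs VP(1,2,4,5)]) (rule that)
  show thesis
  proof (rule that[OF EF])
    have "6 ^ CARD('d) * emeasure M F > 0"
      using \<theta>(1) VP(3) by (intro less_le_trans[OF _ \<theta>(3)]) (simp add: ennreal_zero_less_mult_iff)
    then show "measure M F > 0"
      by (simp add: ennreal_zero_less_mult_iff emeasure_eq_measure)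
    have "6 ^ CARD('d) * (ennreal C * emeasure M E) \<le> 6 ^ CARD('d) * (ennreal C * (emeasure lborel P * \<theta>))"
      by (intro mult_left_mono \<theta>(2)) auto
    also have "\<dots> = ennreal (C * 6 ^ CARD('d)) * emeasure lborel P * \<theta>"
      using C by (simp add: ennreal_mult flip: ennreal_power) (simp add: mult_ac)
    also have "\<dots> \<le> emeasure lborel V * \<theta>"
      by (intro mult_right_mono VP(6)) auto
    also note \<theta>(3)
    finally have "ennreal C * emeasure M E \<le> emeasure M F"
      by (subst (asm) ennreal_mult_le_mult_iff) (auto simp: power_eq_top_ennreal)
    then show "C * measure M E \<le> measure M F"
      using C by (simp add: emeasure_eq_measure flip: ennreal_mult)
    show "\<exists>k\<in>{N..K}. \<forall>t\<in>avg_box (w k) (s k). U t x \<in> E" if "x \<in> F" for x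
    proof -
      from F[OF that] obtain v where v: "v \<in> V" "\<forall>t. (\<forall>e\<in>unit_cube. v + e - t \<in> P) \<longrightarrow> U t x \<in> E"
        by (rule bexE)
      from swept[OF v(1)] obtain k where "k \<in> {N..K}" "\<forall>t\<in>avg_box (w k) (s k). \<forall>e\<in>unit_cube. v + e - t \<in> P"
        by (rule bexE)
      with v(2) show ?thesis by (intro bexI[of _ k]) auto
    qed
  qed
qed

end

section \<open>Spreading by a mixing family\<close>

text \<open>
  Greedy choice: each new pull-back of \<open>F\<close> is almost independent of the part \<open>G\<close> that is still uncovered, so
  it leaves at most the fraction \<open>\<rho> (1 - \<mu> F)\<close> of \<open>G\<close>.
\<close>

lemma (in prob_space) mixing_family_covers:
  assumes mix: "mixing_family M S" and F [measurable]: "F \<in> sets M" and pos: "prob F > 0"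
  shows "\<exists>hs. length hs = m \<and> prob {x\<in>space M. \<forall>h\<in>set hs. S h x \<notin> F} \<le> (1 - prob F / 2) ^ m"
proof (induction m)
  case 0
  then show ?case by simp
next
  case (Suc m)
  have [measurable]: "S h \<in> M \<rightarrow>\<^sub>M M" for h
    using mix by (simp add: mixing_family_def measure_preserving_on_def)
  obtain hs where hs: "length hs = m" "prob {x\<in>space M. \<forall>h\<in>set hs. S h x \<notin> F} \<le> (1 - prob F / 2) ^ m"
    using Suc.IH by blast
  define G where "G = {x\<in>space M. \<forall>h\<in>set hs. S h x \<notin> F}"
  \<comment> \<open>a number above \<open>1\<close> with \<open>\<rho> (1 - \<mu> F) \<le> 1 - \<mu> F / 2\<close>; any number will do if \<open>\<mu> F = 1\<close>\<close>
  define \<rho> where "\<rho> = (if prob F = 1 then 2 else (1 - prob F / 2) / (1 - prob F))"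
  have \<rho>: "\<rho> > 1" "\<rho> * prob (space M - F) \<le> 1 - prob F / 2"
  proof -
    have "\<rho> > 1 \<and> \<rho> * (1 - prob F) \<le> 1 - prob F / 2"
    proof (cases "prob F = 1")
      case False
      then have "prob F < 1"
        using prob_le_1[of F] by linarith
      then show ?thesis
        using pos by (simp add: \<rho>_def less_divide_eq)
    qed (simp add: \<rho>_def)
    then show "\<rho> > 1" "\<rho> * prob (space M - F) \<le> 1 - prob F / 2"
      by (simp_all add: prob_compl)
  qed
  have [measurable]: "G \<in> sets M"
    unfolding G_def by (rule sets.sets_Collect_finite_All) auto
  obtain h where h: "prob (G \<inter> (S h -` (space M - F) \<inter> space M)) \<le> \<rho> * prob G * prob (space M - F)"
    using mix \<rho>(1) \<open>G \<in> sets M\<close> F unfolding mixing_family_def by (meson sets.compl_sets)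
  have "{x\<in>space M. \<forall>h\<in>set (h # hs). S h x \<notin> F} = G \<inter> (S h -` (space M - F) \<inter> space M)"
    using measurable_space[of "S h" M M] by (auto simp: G_def)
  then have "prob {x\<in>space M. \<forall>h\<in>set (h # hs). S h x \<notin> F} \<le> (\<rho> * prob (space M - F)) * prob G"
    using h by (simp add: mult_ac)
  also have "\<dots> \<le> (1 - prob F / 2) * (1 - prob F / 2) ^ m"
    using \<rho> hs(2) order_trans[OF prob_le_1, of 2 F] unfolding G_def by (intro mult_mono) auto
  finally show ?case
    using hs(1) by (intro exI[of _ "h # hs"]) simp
qed

text \<open>
  With \<open>m \<approx> 2 L / \<mu> F\<close> pull-backs the uncovered part is at most \<open>(1 - \<mu> F / 2)\<^sup>m \<le> exp (- L)\<close>, whereas the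
  pull-backs of \<open>E\<close> have total measure at most \<open>m \<mu> E \<le> (2 L + 1) / C\<close>. So first \<open>L\<close> and then \<open>C\<close> can be
  chosen to make both small. Orbit boxes are carried along because the pull-backs commute with the flow.
\<close>

lemma (in mp_flow) ex_almost_full_swept_set:
  assumes mix: "mixing_family M S" and comm: "flow_commutes_with_family M U S" and "\<epsilon> > 0"
    and swept: "\<And>C. C > 0 \<Longrightarrow> \<exists>E\<in>sets M. \<exists>F\<in>sets M. \<exists>K. prob F > 0 \<and> C * prob E \<le> prob F \<and>
        (\<forall>x\<in>F. \<exists>k\<in>{N..K}. \<forall>t\<in>W k. U t x \<in> E)"
  shows "\<exists>E\<in>sets M. \<exists>F\<in>sets M. \<exists>K. prob E < \<epsilon> \<and> prob F > 1 - \<epsilon> \<and>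
        (\<forall>x\<in>F. \<exists>k\<in>{N..K}. \<forall>t\<in>W k. U t x \<in> E)"
proof -
  define L where "L = max 0 (1 - ln \<epsilon>)"
  define C where "C = (2 * L + 2) / \<epsilon>"
  have L: "L \<ge> 0" "exp (- L) < \<epsilon>"
  proof -
    have "exp (- L) \<le> exp (ln \<epsilon> - 1)"
      by (simp add: L_def)
    also have "\<dots> < exp (ln \<epsilon>)"
      by simp
    finally show "exp (- L) < \<epsilon>"
      using \<open>\<epsilon> > 0\<close> by simp
  qed (simp add: L_def)
  have "C > 0"
    using L \<open>\<epsilon> > 0\<close> by (simp add: C_def)
  then obtain E F K where E [measurable]: "E \<in> sets M" and F [measurable]: "F \<in> sets M"
    and f: "prob F > 0" "C * prob E \<le> prob F"
    and FE: "\<And>x. x \<in> F \<Longrightarrow> \<exists>k\<in>{N..K}. \<forall>t\<in>W k. U t x \<in> E"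
    using swept by metis
  define m where "m = nat \<lceil>2 * L / prob F\<rceil>"
  have "real m = of_int \<lceil>2 * L / prob F\<rceil>"
    using L f by (simp add: m_def)
  then have m: "2 * L / prob F \<le> real m" "real m \<le> 2 * L / prob F + 1"
    using of_int_ceiling_le_add_one[of "2 * L / prob F"] by auto
  obtain hs where hs: "length hs = m"
      "prob {x\<in>space M. \<forall>h\<in>set hs. S h x \<notin> F} \<le> (1 - prob F / 2) ^ m"
    using mixing_family_covers[OF mix F f(1)] by blast
  have S_meas [measurable]: "S h \<in> M \<rightarrow>\<^sub>M M" and S_mp: "distr M M (S h) = M" for h
    using mix by (simp_all add: mixing_family_def measure_preserving_on_def)
  define E' where "E' = (\<Union>h\<in>set hs. {x\<in>space M. S h x \<in> E})"
  define F' where "F' = {x\<in>space M. \<exists>h\<in>set hs. S h x \<in> F}"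
  have [measurable]: "E' \<in> sets M"
    unfolding E'_def by (rule sets.finite_UN) auto
  have [measurable]: "F' \<in> sets M"
    unfolding F'_def by (rule sets.sets_Collect_finite_Ex) auto
  show ?thesis
  proof (rule bexI[of _ E'], rule bexI[of _ F'], rule exI[of _ K], intro conjI ballI)
    show "prob E' < \<epsilon>"
    proof -
      have pull: "prob {x\<in>space M. S h x \<in> E} = prob E" for h
      proof -
        have "prob E = measure (distr M M (S h)) E"
          by (simp add: S_mp)
        also have "\<dots> = prob {x\<in>space M. S h x \<in> E}"
          by (subst measure_distr) (auto intro!: arg_cong[where f=prob])
        finally show ?thesis by simp
      qed
      have "prob E' \<le> (\<Sum>h\<in>set hs. prob {x\<in>space M. S h x \<in> E})"
        unfolding E'_def by (intro finite_measure_subadditive_finite) auto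
      also have "\<dots> = real (card (set hs)) * prob E"
        by (simp add: pull)
      also have "\<dots> \<le> (2 * L / prob F + 1) * prob E"
        using m(2) card_length[of hs] hs(1) by (intro mult_right_mono) auto
      also have "\<dots> \<le> (2 * L / prob F + 1) * (prob F / C)"
        using f \<open>C > 0\<close> L by (intro mult_left_mono) (auto simp: field_simps)
      also have "\<dots> = (2 * L + prob F) / C"
        using f \<open>C > 0\<close> by (simp add: field_simps)
      also have "\<dots> < (2 * L + 2) / C"
        using \<open>C > 0\<close> le_less_trans[OF prob_le_1, of 2 F] by (intro divide_strict_right_mono) auto
      also have "\<dots> = \<epsilon>"
        using L \<open>\<epsilon> > 0\<close> by (simp add: C_def)
      finally show ?thesis .
    qed
    show "prob F' > 1 - \<epsilon>"
    proof -
      have "(1 - prob F / 2) ^ m \<le> exp (- (prob F / 2)) ^ m"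
        using order_trans[OF prob_le_1, of 2 F] exp_ge_add_one_self[of "- (prob F / 2)"] by (intro power_mono) auto
      also have "\<dots> = exp (- (real m * prob F / 2))"
        by (simp flip: exp_of_nat_mult)
      also have "\<dots> \<le> exp (- L)"
        using m(1) f by (simp add: field_simps)
      also note L(2)
      finally have "prob {x\<in>space M. \<forall>h\<in>set hs. S h x \<notin> F} < \<epsilon>"
        using hs(2) by simp
      moreover have "{x\<in>space M. \<forall>h\<in>set hs. S h x \<notin> F} = space M - F'"
        by (auto simp: F'_def)
      ultimately show ?thesis
        by (simp add: prob_compl)
    qed
    fix x assume "x \<in> F'"
    then obtain h where h: "h \<in> set hs" "S h x \<in> F" and x: "x \<in> space M"
      by (auto simp: F'_def)
    obtain k where k: "k \<in> {N..K}" "\<forall>t\<in>W k. U t (S h x) \<in> E"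
      using FE[OF h(2)] by blast
    show "\<exists>k\<in>{N..K}. \<forall>t\<in>W k. U t x \<in> E'"
    proof (intro bexI[OF _ k(1)] ballI)
      fix t assume "t \<in> W k"
      then have "S h (U t x) \<in> E"
        using k(2) comm x by (simp add: flow_commutes_with_family_def)
      then show "U t x \<in> E'"
        using h(1) x by (auto simp: E'_def)
    qed
  qed auto
qed

section \<open>Averages of indicator functions\<close>

lemma emeasure_avg_box:
  assumes "\<And>j. s $ j > 0"
  shows "emeasure lborel (avg_box w s) = ennreal (\<Prod>j\<in>UNIV. s $ j)"
proof -
  have "avg_box w s = {t. \<forall>j. t $ j \<in> {w $ j..<w $ j + s $ j}}"
    by (simp add: avg_box_def)
  then have "emeasure lborel (avg_box w s) = (\<Prod>j\<in>UNIV. emeasure lborel {w $ j..<w $ j + s $ j})"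
    by (simp only: emeasure_lborel_vec_product atLeastLessThan_borel)
  also have "\<dots> = (\<Prod>j\<in>UNIV. ennreal (s $ j))"
    using assms by (intro prod.cong) (auto simp: less_imp_le)
  finally show ?thesis
    using assms by (simp add: prod_ennreal less_imp_le)
qed

lemma avg_box_borel [measurable]: "avg_box w s \<in> sets borel"
  unfolding avg_box_def by measurable

context mp_flow begin

context
  fixes s :: "real ^ 'd"
  assumes s: "\<And>j. s $ j > 0"
begin

lemma side_prod_pos: "(\<Prod>j\<in>UNIV. s $ j) > 0"
  using s by (intro prod_pos) auto

lemma occupation_avg_box_finite: "occupation (avg_box w s) A x < top"
proof -
  have "occupation (avg_box w s) A x \<le> emeasure lborel (avg_box w s)"
    unfolding occupation_def by (intro emeasure_mono) auto
  also have "\<dots> < top"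
    using s by (simp add: emeasure_avg_box)
  finally show ?thesis .
qed

lemma avg_op_eq_occupation:
  assumes "x \<in> space M" "A \<in> sets M"
  shows "avg_op U w s (indicator A) x = enn2real (occupation (avg_box w s) A x) / (\<Prod>j\<in>UNIV. s $ j)"
proof -
  note visits_borel[OF assms, measurable]
  have "indicator (avg_box w s) t *\<^sub>R indicator A (U t x) = (indicator (avg_box w s \<inter> visits A x) t :: real)" for t
    by (auto simp: indicator_def visits_def)
  then have "(LINT t:avg_box w s|lborel. indicator A (U t x)) = measure lborel (avg_box w s \<inter> visits A x)"
    by (simp add: set_lebesgue_integral_def)
  then show ?thesis
    by (simp add: avg_op_def occupation_def measure_def)
qed

lemma avg_op_nonneg:
  assumes "x \<in> space M" "A \<in> sets M"
  shows "0 \<le> avg_op U w s (indicator A) x"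
  using side_prod_pos by (simp add: avg_op_eq_occupation[OF assms])

lemma avg_op_trivial:
  assumes "x \<in> space M"
  shows "avg_op U w s (indicator (space M)) x = 1" "avg_op U w s (indicator {}) x = 0"
proof -
  have "visits (space M) x = UNIV" "visits {} x = {}"
    using assms by (auto simp: visits_def)
  moreover have "s $ j \<noteq> 0" for j
    using s[of j] by simp
  ultimately show "avg_op U w s (indicator (space M)) x = 1" "avg_op U w s (indicator {}) x = 0"
    using assms side_prod_pos s by (simp_all add: avg_op_eq_occupation occupation_def emeasure_avg_box)
qed

text \<open>
  Subadditivity in the form used below: the covering of \<open>A\<close> by \<open>A1\<close> and \<open>A2\<close> is needed only along the piece
  of the orbit of \<open>x\<close> over which the average is taken.
\<close>

lemma avg_op_le_add:
  assumes x: "x \<in> space M" and [measurable]: "A \<in> sets M" "A1 \<in> sets M" "A2 \<in> sets M"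
    and cover: "\<And>t. t \<in> avg_box w s \<Longrightarrow> U t x \<in> A \<Longrightarrow> U t x \<in> A1 \<or> U t x \<in> A2"
  shows "avg_op U w s (indicator A) x \<le> avg_op U w s (indicator A1) x + avg_op U w s (indicator A2) x"
proof -
  have [measurable]: "visits A x \<in> sets borel" "visits A1 x \<in> sets borel" "visits A2 x \<in> sets borel"
    using x by auto
  have "occupation (avg_box w s) A x
      \<le> emeasure lborel ((avg_box w s \<inter> visits A1 x) \<union> (avg_box w s \<inter> visits A2 x))"
    unfolding occupation_def
  proof (rule emeasure_mono)
    show "avg_box w s \<inter> visits A x \<subseteq> (avg_box w s \<inter> visits A1 x) \<union> (avg_box w s \<inter> visits A2 x)"
      using cover by (auto simp: visits_def)
  qed measurable
  also have "\<dots> \<le> occupation (avg_box w s) A1 x + occupation (avg_box w s) A2 x"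
    unfolding occupation_def by (intro emeasure_subadditive; measurable)
  finally have "enn2real (occupation (avg_box w s) A x)
      \<le> enn2real (occupation (avg_box w s) A1 x + occupation (avg_box w s) A2 x)"
    using occupation_avg_box_finite by (intro enn2real_mono) auto
  also have "\<dots> = enn2real (occupation (avg_box w s) A1 x) + enn2real (occupation (avg_box w s) A2 x)"
    by (rule enn2real_plus) (rule occupation_avg_box_finite)+
  finally show ?thesis
    using x side_prod_pos by (simp add: avg_op_eq_occupation divide_right_mono flip: add_divide_distrib)
qed

lemma avg_op_le_1:
  assumes "x \<in> space M" "A \<in> sets M"
  shows "avg_op U w s (indicator A) x \<le> 1"
  using avg_op_le_add[of x A "space M" "{}" w] assms avg_op_trivial[OF assms(1)] by auto

lemma avg_op_measurable [measurable]:
  assumes [measurable]: "A \<in> sets M"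
  shows "avg_op U w s (indicator A) \<in> borel_measurable M"
  by (subst measurable_cong[OF avg_op_eq_occupation]) auto

text \<open>
  Markov's inequality, since the average of \<open>\<chi>\<^sub>A\<close> has integral \<open>\<mu> A\<close>.
\<close>

lemma prob_avg_op_ge:
  assumes A [measurable]: "A \<in> sets M" and c: "c > 0"
  shows "prob {x\<in>space M. c \<le> avg_op U w s (indicator A) x} \<le> prob A / c"
proof -
  define p where "p = (\<Prod>j\<in>UNIV. s $ j)"
  have p: "p > 0" "emeasure lborel (avg_box w s) = ennreal p"
    using side_prod_pos s by (simp_all add: p_def emeasure_avg_box)
  have avg: "ennreal (avg_op U w s (indicator A) x) = ennreal (1 / p) * occupation (avg_box w s) A x"
    if "x \<in> space M" for x
  proof -
    have "occupation (avg_box w s) A x = ennreal (enn2real (occupation (avg_box w s) A x))"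
      using occupation_avg_box_finite by simp
    then show ?thesis
      using p(1) that by (metis A avg_op_eq_occupation divide_inverse ennreal_mult'
        inverse_eq_divide less_imp_le mult.commute zero_le_divide_1_iff p_def)
  qed
  have "(\<integral>\<^sup>+x. ennreal (avg_op U w s (indicator A) x) \<partial>M)
      = (\<integral>\<^sup>+x. ennreal (1 / p) * occupation (avg_box w s) A x \<partial>M)"
    by (intro nn_integral_cong avg)
  also have "\<dots> = ennreal (1 / p) * (ennreal p * emeasure M A)"
    by (simp add: nn_integral_cmult nn_integral_occupation p)
  also have "\<dots> = ennreal (prob A)"
    using p(1) by (simp add: emeasure_eq_measure flip: ennreal_mult)
  finally have integral: "(\<integral>\<^sup>+x. ennreal (avg_op U w s (indicator A) x) \<partial>M) = ennreal (prob A)" .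
  have "{x\<in>space M. c \<le> avg_op U w s (indicator A) x}
      = {x\<in>space M. 1 \<le> ennreal (1 / c) * ennreal (avg_op U w s (indicator A) x)}"
    using c by (auto simp: field_simps avg_op_nonneg simp flip: ennreal_mult ennreal_1)
  then have "emeasure M {x\<in>space M. c \<le> avg_op U w s (indicator A) x}
      \<le> ennreal (1 / c) * (\<integral>\<^sup>+x. ennreal (avg_op U w s (indicator A) x) * indicator (space M) x \<partial>M)"
    by (simp only:) (intro nn_integral_Markov_inequality; measurable)
  also have "(\<integral>\<^sup>+x. ennreal (avg_op U w s (indicator A) x) * indicator (space M) x \<partial>M) = ennreal (prob A)"
    unfolding integral[symmetric] by (intro nn_integral_cong) auto
  finally show ?thesis
    using c by (simp add: emeasure_eq_measure flip: ennreal_mult)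
qed

end

end

section \<open>Alternating construction of the sweeping set\<close>

text \<open>
  Information about odd \<open>n\<close> is enough for an upper limit, and about even \<open>n\<close> for a lower one, as
  \<open>k \<ge> n\<close> ensures that arbitrarily late terms are concerned.
\<close>

lemma limsup_eq_1:
  fixes a :: "nat \<Rightarrow> real"
  assumes le: "\<And>k. a k \<le> 1"
    and ge: "eventually (\<lambda>n. odd n \<longrightarrow> (\<exists>k\<ge>n. a k \<ge> 1 - (1 / 2) ^ n)) sequentially"
  shows "limsup (\<lambda>k. ereal (a k)) = 1"
proof (rule antisym)
  show "limsup (\<lambda>k. ereal (a k)) \<le> 1"
    using le by (intro Limsup_bounded) auto
  obtain n0 where n0: "\<And>n. n \<ge> n0 \<Longrightarrow> odd n \<Longrightarrow> \<exists>k\<ge>n. a k \<ge> 1 - (1 / 2) ^ n"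
    using ge by (auto simp: eventually_sequentially)
  have "(\<lambda>j. (1 / 2 :: real) ^ j) \<longlonglongrightarrow> 0"
    by (rule LIMSEQ_realpow_zero) auto
  moreover have "filterlim (\<lambda>j. 2 * j + 1 :: nat) at_top sequentially"
    by (rule filterlim_subseq) (simp add: strict_mono_def)
  ultimately have "(\<lambda>j. (1 / 2 :: real) ^ (2 * j + 1)) \<longlonglongrightarrow> 0"
    by (rule filterlim_compose)
  then have "(\<lambda>j. ereal (1 - (1 / 2) ^ (2 * j + 1))) \<longlonglongrightarrow> ereal (1 - 0)"
    by (intro tendsto_intros)
  then have lim: "(\<lambda>j. ereal (1 - (1 / 2) ^ (2 * j + 1))) \<longlonglongrightarrow> 1"
    by (simp only: diff_zero one_ereal_def)
  show "1 \<le> limsup (\<lambda>k. ereal (a k))"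
    unfolding limsup_INF_SUP
  proof (rule INF_greatest)
    fix n
    have "ereal (1 - (1 / 2) ^ (2 * j + 1)) \<le> (SUP m\<in>{n..}. ereal (a m))" if j: "j \<ge> n + n0" for j
    proof -
      obtain k where "k \<ge> 2 * j + 1" "a k \<ge> 1 - (1 / 2) ^ (2 * j + 1)"
        using n0[of "2 * j + 1"] j by auto
      then show ?thesis
        using j by (intro SUP_upper2[of k]) auto
    qed
    then show "1 \<le> (SUP m\<in>{n..}. ereal (a m))"
      by (intro LIMSEQ_le_const2[OF lim]) auto
  qed
qed

lemma liminf_eq_0:
  fixes a :: "nat \<Rightarrow> real"
  assumes ge: "\<And>k. 0 \<le> a k"
    and le: "eventually (\<lambda>n. even n \<longrightarrow> (\<exists>k\<ge>n. a k \<le> (1 / 2) ^ n)) sequentially"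
  shows "liminf (\<lambda>k. ereal (a k)) = 0"
proof (rule antisym)
  show "0 \<le> liminf (\<lambda>k. ereal (a k))"
    using ge by (intro Liminf_bounded) auto
  obtain n0 where n0: "\<And>n. n \<ge> n0 \<Longrightarrow> even n \<Longrightarrow> \<exists>k\<ge>n. a k \<le> (1 / 2) ^ n"
    using le by (auto simp: eventually_sequentially)
  have "(\<lambda>j. (1 / 2 :: real) ^ j) \<longlonglongrightarrow> 0"
    by (rule LIMSEQ_realpow_zero) auto
  moreover have "filterlim (\<lambda>j. 2 * j :: nat) at_top sequentially"
    by (rule filterlim_subseq) (simp add: strict_mono_def)
  ultimately have "(\<lambda>j. (1 / 2 :: real) ^ (2 * j)) \<longlonglongrightarrow> 0"
    by (rule filterlim_compose)
  then have lim: "(\<lambda>j. ereal ((1 / 2) ^ (2 * j))) \<longlonglongrightarrow> 0"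
    by (simp add: zero_ereal_def)
  show "liminf (\<lambda>k. ereal (a k)) \<le> 0"
    unfolding liminf_SUP_INF
  proof (rule SUP_least)
    fix n
    have "(INF m\<in>{n..}. ereal (a m)) \<le> ereal ((1 / 2) ^ (2 * j))" if j: "j \<ge> n + n0" for j
    proof -
      obtain k where "k \<ge> 2 * j" "a k \<le> (1 / 2) ^ (2 * j)"
        using n0[of "2 * j"] j by auto
      then show ?thesis
        using j by (intro INF_lower2[of k]) auto
    qed
    then show "(INF m\<in>{n..}. ereal (a m)) \<le> 0"
      by (intro LIMSEQ_le_const[OF lim]) auto
  qed
qed

lemma (in prob_space) prob_UN_geometric_le:
  assumes [measurable]: "\<And>m. A m \<in> sets M" and le: "\<And>m. prob (A m) \<le> c * (1 / 4) ^ Suc m"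
  shows "prob (\<Union>m. A m) \<le> c / 3"
proof -
  have sums: "(\<lambda>m. c / 4 * (1 / 4) ^ m) sums (c / 4 * (1 / (1 - 1 / 4)))"
    by (intro sums_mult geometric_sums) auto
  have le': "prob (A m) \<le> c / 4 * (1 / 4) ^ m" for m
    using le[of m] by simp
  have summable: "summable (\<lambda>m. prob (A m))"
    by (rule summable_comparison_test'[OF sums_summable[OF sums], of 0]) (use le' in auto)
  have "prob (\<Union>m. A m) \<le> (\<Sum>m. prob (A m))"
    using summable by (intro finite_measure_subadditive_countably) auto
  also have "\<dots> \<le> (\<Sum>m. c / 4 * (1 / 4) ^ m)"
    by (intro suminf_le le' summable sums_summable[OF sums])
  also have "\<dots> = c / 3"
    using sums_unique[OF sums] by simp
  finally show ?thesis .
qed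

text \<open>
  A point that lies in only finitely many of the sets \<open>E n\<close> belongs to \<open>B\<close> iff the last of them has an odd
  index. Up to the tail
  \<open>T n\<close>, the union of all later sets, \<open>E n\<close> is therefore contained in \<open>B\<close> if \<open>n\<close> is odd and disjoint from
  \<open>B\<close> if \<open>n\<close> is even. The indices of the boxes at stage \<open>n\<close> are at most \<open>K n\<close>, a number that is known before the
  later sets are chosen; so \<open>\<mu> (T n)\<close> can be made so small that even the maximum over \<open>k \<le> K n\<close> of the
  averages of the indicator of \<open>T n\<close> reaches \<open>2\<^sup>-\<^sup>n\<close> with probability at most \<open>2\<^sup>-\<^sup>n\<close> only. The Borel--Cantelli lemma
  turns this into a statement for almost every point.
\<close>

lemma (in mp_flow) strong_sweeping_out_if_swept:
  fixes w s :: "nat \<Rightarrow> real ^ 'd"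
  assumes s: "\<And>k j. s k $ j > 0"
    and swept: "\<And>\<epsilon> N. \<epsilon> > 0 \<Longrightarrow> \<exists>E\<in>sets M. \<exists>F\<in>sets M. \<exists>K. prob E < \<epsilon> \<and> prob F > 1 - \<epsilon> \<and>
        (\<forall>x\<in>F. \<exists>k\<in>{N..K}. \<forall>t\<in>avg_box (w k) (s k). U t x \<in> E)"
  shows "strong_sweeping_out M (\<lambda>k. avg_op U (w k) (s k))"
  unfolding strong_sweeping_out_def
proof (intro allI impI)
  fix \<epsilon>0 :: real assume "\<epsilon>0 > 0"
  define \<epsilon> where "\<epsilon> = min \<epsilon>0 1"
  have \<epsilon>: "0 < \<epsilon>" "\<epsilon> \<le> 1" "\<epsilon> \<le> \<epsilon>0"
    using \<open>\<epsilon>0 > 0\<close> by (auto simp: \<epsilon>_def)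
  define good :: "nat \<Rightarrow> 'a set \<times> 'a set \<times> nat \<Rightarrow> bool" where
    "good n = (\<lambda>(E, F, K). E \<in> sets M \<and> F \<in> sets M \<and> prob E \<le> \<epsilon> * (1 / 4) ^ Suc n \<and> prob F \<ge> 1 - (1 / 2) ^ n \<and>
        (\<forall>x\<in>F. \<exists>k\<in>{n..K}. \<forall>t\<in>avg_box (w k) (s k). U t x \<in> E))" for n
  \<comment> \<open>the division by \<open>K + 1\<close> pays for the number of averages at the earlier stages\<close>
  define next_ok :: "nat \<Rightarrow> 'a set \<times> 'a set \<times> nat \<Rightarrow> 'a set \<times> 'a set \<times> nat \<Rightarrow> bool" where
    "next_ok n = (\<lambda>(E, F, K) (E', F', K'). K \<le> K' \<and> prob E' \<le> \<epsilon> * (1 / 4) ^ Suc (Suc n) / (real K + 1))" for n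
  have ex_good: "\<exists>E F K. good n (E, F, K) \<and> K0 \<le> K \<and> prob E \<le> \<epsilon> * (1 / 4) ^ Suc n / (real K0 + 1)" for n K0 :: nat
  proof -
    define \<delta> where "\<delta> = \<epsilon> * (1 / 4) ^ Suc n / (real K0 + 1)"
    have \<delta>: "\<delta> > 0" "\<delta> \<le> \<epsilon> * (1 / 4) ^ Suc n"
    proof -
      show "\<delta> > 0" using \<epsilon> by (simp add: \<delta>_def)
      have "\<delta> \<le> \<epsilon> * (1 / 4) ^ Suc n / 1"
        unfolding \<delta>_def using \<epsilon> by (intro divide_left_mono) auto
      then show "\<delta> \<le> \<epsilon> * (1 / 4) ^ Suc n" by simp
    qed
    have "\<epsilon> * (1 / 4) ^ Suc n \<le> 1 * (1 / 2) ^ n"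
    proof (intro mult_mono)
      have "(1 / 4 :: real) ^ Suc n \<le> (1 / 4) ^ n" by simp
      also have "\<dots> \<le> (1 / 2) ^ n" by (intro power_mono) auto
      finally show "(1 / 4 :: real) ^ Suc n \<le> (1 / 2) ^ n" .
    qed (use \<epsilon> in auto)
    with \<delta> have \<delta>': "\<delta> \<le> (1 / 2) ^ n" by simp
    obtain E F K where EFK: "E \<in> sets M" "F \<in> sets M" "prob E < \<delta>" "prob F > 1 - \<delta>"
        and hit: "\<forall>x\<in>F. \<exists>k\<in>{n..K}. \<forall>t\<in>avg_box (w k) (s k). U t x \<in> E"
      using swept[OF \<delta>(1)] by metis
    have hit': "\<forall>x\<in>F. \<exists>k\<in>{n..max K K0}. \<forall>t\<in>avg_box (w k) (s k). U t x \<in> E"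
    proof
      fix x assume "x \<in> F"
      with hit obtain k where "k \<in> {n..K}" "\<forall>t\<in>avg_box (w k) (s k). U t x \<in> E"
        by meson
      then show "\<exists>k\<in>{n..max K K0}. \<forall>t\<in>avg_box (w k) (s k). U t x \<in> E"
        by (intro bexI[of _ k]) auto
    qed
    show ?thesis
    proof (intro exI conjI)
      show "good n (E, F, max K K0)"
        using EFK hit' \<delta>(2) \<delta>' by (simp add: good_def)
      show "prob E \<le> \<epsilon> * (1 / 4) ^ Suc n / (real K0 + 1)"
        using EFK(3) by (simp add: \<delta>_def)
    qed simp
  qed
  have "\<exists>f. \<forall>n. good n (f n) \<and> next_ok n (f n) (f (Suc n))"
  proof (rule dependent_nat_choice)
    show "\<exists>p. good 0 p"
      using ex_good[of 0 0] by blast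
    fix p :: "'a set \<times> 'a set \<times> nat" and n
    obtain E F K where p: "p = (E, F, K)" by (cases p)
    obtain E' F' K' where p': "good (Suc n) (E', F', K')" "K \<le> K'"
        "prob E' \<le> \<epsilon> * (1 / 4) ^ Suc (Suc n) / (real K + 1)"
      using ex_good[of "Suc n" K] by blast
    then show "\<exists>p'. good (Suc n) p' \<and> next_ok n p p'"
      by (intro exI[of _ "(E', F', K')"]) (simp add: next_ok_def p)
  qed
  then obtain f where f: "\<And>n. good n (f n)" "\<And>n. next_ok n (f n) (f (Suc n))"
    by blast
  define E F K where "E n = fst (f n)" and "F n = fst (snd (f n))" and "K n = snd (snd (f n))" for n
  have f_eq: "f n = (E n, F n, K n)" for n
    by (simp add: E_def F_def K_def)
  have E_meas [measurable]: "E n \<in> sets M" and F_meas [measurable]: "F n \<in> sets M"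
    and E_small: "prob (E n) \<le> \<epsilon> * (1 / 4) ^ Suc n" and F_large: "prob (F n) \<ge> 1 - (1 / 2) ^ n"
    and hit: "\<And>x. x \<in> F n \<Longrightarrow> \<exists>k\<in>{n..K n}. \<forall>t\<in>avg_box (w k) (s k). U t x \<in> E n"
    and K_Suc: "K n \<le> K (Suc n)"
    and E_Suc: "prob (E (Suc n)) \<le> \<epsilon> * (1 / 4) ^ Suc (Suc n) / (real (K n) + 1)" for n
    using f[of n] by (auto simp: f_eq good_def next_ok_def)
  define T where "T n = (\<Union>m. E (n + Suc m))" for n
  have [measurable]: "T n \<in> sets M" for n
    unfolding T_def by auto
  have T_small: "prob (T n) \<le> (1 / 4) ^ n / (real (K n) + 1)" for n
  proof -
    have "prob (T n) \<le> ((1 / 4) ^ n / (real (K n) + 1)) / 3"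
      unfolding T_def
    proof (rule prob_UN_geometric_le)
      fix m
      have "K n \<le> K (n + m)"
        by (rule lift_Suc_mono_le[of K, OF K_Suc]) simp
      have "prob (E (n + Suc m)) \<le> \<epsilon> * (1 / 4) ^ Suc (Suc (n + m)) / (real (K (n + m)) + 1)"
        using E_Suc[of "n + m"] by simp
      also have "\<dots> \<le> 1 * (1 / 4) ^ (n + Suc m) / (real (K n) + 1)"
        using \<epsilon> \<open>K n \<le> K (n + m)\<close> by (intro frac_le mult_mono) auto
      also have "\<dots> = (1 / 4) ^ n / (real (K n) + 1) * (1 / 4) ^ Suc m"
        by (simp add: power_add)
      finally show "prob (E (n + Suc m)) \<le> (1 / 4) ^ n / (real (K n) + 1) * (1 / 4) ^ Suc m" .
    qed auto
    also have "\<dots> \<le> ((1 / 4) ^ n / (real (K n) + 1)) / 1"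
      by (intro divide_left_mono) auto
    finally have "prob (T n) \<le> ((1 / 4) ^ n / (real (K n) + 1)) / 1" .
    then show ?thesis by simp
  qed
  define B where "B = {x\<in>space M. \<exists>n. odd n \<and> x \<in> E n \<and> (\<forall>m. x \<in> E (n + Suc m) \<longrightarrow> odd (n + Suc m))}"
  have [measurable]: "B \<in> sets M"
    unfolding B_def by measurable
  have odd_B: "x \<in> B \<or> x \<in> T n" if "odd n" "x \<in> E n" "x \<in> space M" for x n
    using that by (auto simp: B_def T_def)
  have even_B: "x \<in> T n" if n: "even n" "x \<in> E n" and "x \<in> B" for x n
  proof -
    obtain n' where n': "odd n'" "x \<in> E n'" "\<And>m. x \<in> E (n' + Suc m) \<Longrightarrow> odd (n' + Suc m)"
      using \<open>x \<in> B\<close> by (auto simp: B_def)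
    have "n < n'"
    proof (rule ccontr)
      assume "\<not> n < n'"
      moreover have "n \<noteq> n'" using n(1) n'(1) by auto
      ultimately have "n = n' + Suc (n - n' - 1)" by simp
      then show False
        using n'(3)[of "n - n' - 1"] n by metis
    qed
    then have "n' = n + Suc (n' - n - 1)" by simp
    then show ?thesis
      using n'(2) unfolding T_def by (metis UN_I UNIV_I)
  qed
  define bad where "bad n = (\<Union>k\<le>K n. {x\<in>space M. (1 / 2) ^ n \<le> avg_op U (w k) (s k) (indicator (T n)) x})" for n
  note avg_op_measurable[OF s, measurable]
  have bad_meas [measurable]: "bad n \<in> sets M" for n
    unfolding bad_def by measurable
  have bad_small: "prob (bad n) \<le> (1 / 2) ^ n" for n
  proof -
    have "prob (bad n) \<le> (\<Sum>k\<le>K n. prob {x\<in>space M. (1 / 2) ^ n \<le> avg_op U (w k) (s k) (indicator (T n)) x})"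
      unfolding bad_def by (intro finite_measure_subadditive_finite) auto
    also have "\<dots> \<le> (\<Sum>k\<le>K n. prob (T n) / (1 / 2) ^ n)"
      by (intro sum_mono prob_avg_op_ge s) auto
    also have "\<dots> = (real (K n) + 1) * prob (T n) / (1 / 2) ^ n"
      by simp
    also have "\<dots> \<le> (real (K n) + 1) * ((1 / 4) ^ n / (real (K n) + 1)) / (1 / 2) ^ n"
      by (intro divide_right_mono mult_left_mono T_small) auto
    also have "\<dots> = (1 / 4) ^ n / (1 / 2) ^ n"
      by simp
    also have "\<dots> = (1 / 2) ^ n"
      by (simp flip: power_divide)
    finally show ?thesis .
  qed
  have "summable (\<lambda>n. prob (bad n \<union> (space M - F n)))"
  proof (rule summable_comparison_test'[of "\<lambda>n. 2 * (1 / 2 :: real) ^ n" 0])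
    show "summable (\<lambda>n. 2 * (1 / 2 :: real) ^ n)"
      by (intro summable_mult summable_geometric) auto
    fix n
    have "prob (bad n \<union> (space M - F n)) \<le> prob (bad n) + prob (space M - F n)"
      by (rule measure_Un_le) auto
    also have "\<dots> \<le> 2 * (1 / 2) ^ n"
      using bad_small[of n] F_large[of n] by (simp add: prob_compl)
    finally show "norm (prob (bad n \<union> (space M - F n))) \<le> 2 * (1 / 2) ^ n"
      by simp
  qed
  then have "AE x in M. eventually (\<lambda>n. x \<in> space M - (bad n \<union> (space M - F n))) sequentially"
    by (intro borel_cantelli_AE1) (auto simp: emeasure_eq_measure)
  with AE_space have ae: "AE x in M. x \<in> space M \<and> eventually (\<lambda>n. x \<in> F n \<and> x \<notin> bad n) sequentially"
    by eventually_elim (auto elim: eventually_mono)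
  have "AE x in M. liminf (\<lambda>k. ereal (avg_op U (w k) (s k) (indicator B) x)) = 0 \<and>
                   limsup (\<lambda>k. ereal (avg_op U (w k) (s k) (indicator B) x)) = 1"
    using ae
  proof eventually_elim
    case (elim x)
    then have x: "x \<in> space M" and ev: "eventually (\<lambda>n. x \<in> F n \<and> x \<notin> bad n) sequentially" by auto
    have ex_k: "\<exists>k\<ge>n. (\<forall>t\<in>avg_box (w k) (s k). U t x \<in> E n) \<and>
        avg_op U (w k) (s k) (indicator (T n)) x < (1 / 2) ^ n" if n: "x \<in> F n" "x \<notin> bad n" for n
    proof -
      obtain k where "k \<in> {n..K n}" "\<forall>t\<in>avg_box (w k) (s k). U t x \<in> E n"
        using hit[OF n(1)] by (rule bexE)
      then show ?thesis
        using n(2) x by (intro exI[of _ k]) (auto simp: bad_def not_le)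
    qed
    have "eventually (\<lambda>n. even n \<longrightarrow> (\<exists>k\<ge>n. avg_op U (w k) (s k) (indicator B) x \<le> (1 / 2) ^ n)) sequentially"
      using ev
    proof eventually_elim
      case (elim n)
      then obtain k where k: "k \<ge> n" "\<forall>t\<in>avg_box (w k) (s k). U t x \<in> E n"
          "avg_op U (w k) (s k) (indicator (T n)) x < (1 / 2) ^ n"
        using ex_k by blast
      show ?case
      proof (intro impI exI[of _ k] conjI k(1))
        assume "even n"
        then have "avg_op U (w k) (s k) (indicator B) x
            \<le> avg_op U (w k) (s k) (indicator (T n)) x + avg_op U (w k) (s k) (indicator {}) x"
          using even_B k(2) by (intro avg_op_le_add s x) auto
        then show "avg_op U (w k) (s k) (indicator B) x \<le> (1 / 2) ^ n"
          using k(3) avg_op_trivial[OF s x] by simp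
      qed
    qed
    then have "liminf (\<lambda>k. ereal (avg_op U (w k) (s k) (indicator B) x)) = 0"
      by (intro liminf_eq_0 avg_op_nonneg[OF s x]) auto
    moreover have "eventually (\<lambda>n. odd n \<longrightarrow> (\<exists>k\<ge>n. avg_op U (w k) (s k) (indicator B) x \<ge> 1 - (1 / 2) ^ n)) sequentially"
      using ev
    proof eventually_elim
      case (elim n)
      then obtain k where k: "k \<ge> n" "\<forall>t\<in>avg_box (w k) (s k). U t x \<in> E n"
          "avg_op U (w k) (s k) (indicator (T n)) x < (1 / 2) ^ n"
        using ex_k by blast
      show ?case
      proof (intro impI exI[of _ k] conjI k(1))
        assume "odd n"
        then have "avg_op U (w k) (s k) (indicator (space M)) x
            \<le> avg_op U (w k) (s k) (indicator B) x + avg_op U (w k) (s k) (indicator (T n)) x"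
          using odd_B k(2) by (intro avg_op_le_add s x) auto
        then show "avg_op U (w k) (s k) (indicator B) x \<ge> 1 - (1 / 2) ^ n"
          using k(3) avg_op_trivial[OF s x] by simp
      qed
    qed
    then have "limsup (\<lambda>k. ereal (avg_op U (w k) (s k) (indicator B) x)) = 1"
      by (intro limsup_eq_1 avg_op_le_1[OF s x]) auto
    ultimately show ?case by blast
  qed
  moreover have "prob B < \<epsilon>0"
  proof -
    have "prob B \<le> prob (\<Union>n. E n)"
      by (intro finite_measure_mono) (auto simp: B_def)
    also have "\<dots> \<le> \<epsilon> / 3"
      by (intro prob_UN_geometric_le E_small E_meas)
    finally show ?thesis
      using \<epsilon> by simp
  qed
  ultimately show "\<exists>B\<in>sets M. prob B < \<epsilon>0 \<and>
        (AE x in M. liminf (\<lambda>k. ereal (avg_op U (w k) (s k) (indicator B) x)) = 0 \<and>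
                    limsup (\<lambda>k. ereal (avg_op U (w k) (s k) (indicator B) x)) = 1)"
    by (intro bexI[of _ B]) auto
qed

theorem theorem1p5:
  fixes M :: "'a measure"
    and U :: "real ^ 'd \<Rightarrow> 'a \<Rightarrow> 'a"
    and S :: "'h \<Rightarrow> 'a \<Rightarrow> 'a"
    and w s :: "nat \<Rightarrow> real ^ 'd"
    and i :: 'd
  assumes "prob_space M" and "nonatomic M" and "countably_separated_ae M"
    and "measurable_mp_flow M U"
    and "\<And>k j. s k $ j > 0"
    and "aperiodic_flow M U"
    and "mixing_family M S" and "flow_commutes_with_family M U S"
    and "\<And>A \<alpha>. A > 0 \<Longrightarrow> \<alpha> > 0 \<Longrightarrow>
           \<not> bdd_above {y. y > 0 \<and>
               emeasure lborel (cone_section (Omega w s i) \<alpha> y) \<ge> ennreal (A * y)}"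
  shows "strong_sweeping_out M (\<lambda>k. avg_op U (w k) (s k))"
proof -
  interpret mp_flow M U
    using assms(1,4) by (simp add: mp_flow_def mp_flow_axioms_def)
  show ?thesis
  proof (rule strong_sweeping_out_if_swept[OF assms(5)], rule ex_almost_full_swept_set[OF assms(7,8)])
    fix N and C :: real assume "C > 0"
    show "\<exists>E\<in>sets M. \<exists>F\<in>sets M. \<exists>K. prob F > 0 \<and> C * prob E \<le> prob F \<and>
        (\<forall>x\<in>F. \<exists>k\<in>{N..K}. \<forall>t\<in>avg_box (w k) (s k). U t x \<in> E)"
    proof (rule ex_swept_set[OF assms(6,3,5) \<open>C > 0\<close> assms(9), where N=N])
      fix E F K
      assume "E \<in> sets M" "F \<in> sets M" "prob F > 0" "C * prob E \<le> prob F"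
        and "\<And>x. x \<in> F \<Longrightarrow> \<exists>k\<in>{N..K}. \<forall>t\<in>avg_box (w k) (s k). U t x \<in> E"
      then show ?thesis
        by - (rule bexI[of _ E], rule bexI[of _ F], rule exI[of _ K], auto)
    qed
  qed
qed

end
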